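(* Every finitely generated metabelian Lie $U$-algebra $A$ over a field $k$ is isomorphic to a subalgebra of the matrix metabelian Lie algebra $M^0_{I,\Lambda}$ for some sets $I$ and $\Lambda$. Conversely, for any sets $I,\Lambda$, every subalgebra of $M^0_{I,\Lambda}$ is a metabelian Lie $U$-algebra.
   Context: All algebras are over a fixed field $k$. A Lie algebra $A$ is metabelian if $(a\circ b)\circ(c\circ d)=0$ for all $a,b,c,d\in A$. $A^2$ denotes the ideal spanned by all products $a\circ b$. The Fitting radical $\mathrm{Fit}(A)$ is the ideal generated by all elements lying in nilpotent ideals of $A$. If $J$ is an abelian ideal of a metabelian Lie algebra $A$ with $A^2\subseteq J$, choose a family $\{a_\alpha:\alpha\in\Lambda\}$ of elements of $A$ whose images form a basis of $A/J$ and let $R=k[x_\alpha:\alpha\in\Lambda]$ be the commutative polynomial ring; $J$ becomes an $R$-module via $b\cdot x_\alpha=b\circ a_\alpha$ ($b\in J$), extended multiplicatively and $k$-linearly (well defined; another choice of family changes the variables by an invertible linear substitution). A metabelian Lie algebra $A$ is a (metabelian Lie) $U$-algebra if $\mathrm{Fit}(A)$ is abelian and $\mathrm{Fit}(A)$, with this $R$-module structure (taking $J=\mathrm{Fit}(A)$), is torsion-free. Matrix algebras: for sets $I,\Lambda$ let $R=k[x_\alpha:\alpha\in\Lambda]$ and $T$ the free $R$-module with basis $\{u_i:i\in I\}$; $M_{I,\Lambda}$ is the set of pairs $(f,u)$, $f\in R$, $u\in T$ (matrices $\begin{pmatrix} f&u\\0&0\end{pmatrix}$), with componentwise addition and scalar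 multiplication and product $(f,u)\circ(g,v)=(0,\,u g-v f)$; it is a metabelian Lie $k$-algebra. $M^0_{I,\Lambda}$ is the subalgebra of all $(f,u)$ with $f$ a $k$-linear combination of the variables $x_\alpha$ (possibly $f=0$). $\Lambda=\emptyset$ is allowed (then $R=k$). *)

theory Defs
  imports Complex_Main "HOL-Library.Poly_Mapping" "HOL-Library.Product_Plus"
begin

definition lie_algebra :: "('k::field \<Rightarrow> 'a::ab_group_add \<Rightarrow> 'a) \<Rightarrow> ('a \<Rightarrow> 'a \<Rightarrow> 'a) \<Rightarrow> 'a set \<Rightarrow> bool" where
  "lie_algebra sc br A \<longleftrightarrow> vector_space sc \<and> module.subspace sc A
     \<and> (\<forall>x\<in>A. \<forall>y\<in>A. br x y \<in> A)
     \<and> (\<forall>x\<in>A. \<forall>y\<in>A. \<forall>z\<in>A. br (x + y) z = br x z + br y z \<and> br z (x + y) = br z x + br z y)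
     \<and> (\<forall>c. \<forall>x\<in>A. \<forall>y\<in>A. br (sc c x) y = sc c (br x y) \<and> br x (sc c y) = sc c (br x y))
     \<and> (\<forall>x\<in>A. br x x = 0)
     \<and> (\<forall>x\<in>A. \<forall>y\<in>A. \<forall>z\<in>A. br x (br y z) + br y (br z x) + br z (br x y) = 0)"

definition lie_subalgebra :: "('k::field \<Rightarrow> 'a::ab_group_add \<Rightarrow> 'a) \<Rightarrow> ('a \<Rightarrow> 'a \<Rightarrow> 'a) \<Rightarrow> 'a set \<Rightarrow> 'a set \<Rightarrow> bool" where
  "lie_subalgebra sc br A T \<longleftrightarrow> T \<subseteq> A \<and> module.subspace sc T \<and> (\<forall>x\<in>T. \<forall>y\<in>T. br x y \<in> T)"

definition lie_ideal :: "('k::field \<Rightarrow> 'a::ab_group_add \<Rightarrow> 'a) \<Rightarrow> ('a \<Rightarrow> 'a \<Rightarrow> 'a) \<Rightarrow> 'a set \<Rightarrow> 'a set \<Rightarrow> bool" where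
  "lie_ideal sc br A J \<longleftrightarrow> J \<subseteq> A \<and> module.subspace sc J \<and> (\<forall>x\<in>J. \<forall>a\<in>A. br x a \<in> J)"

definition lie_generated :: "('k::field \<Rightarrow> 'a::ab_group_add \<Rightarrow> 'a) \<Rightarrow> ('a \<Rightarrow> 'a \<Rightarrow> 'a) \<Rightarrow> 'a set \<Rightarrow> 'a set \<Rightarrow> 'a set" where
  "lie_generated sc br A X = \<Inter>{T. lie_subalgebra sc br A T \<and> X \<subseteq> T}"

definition finitely_generated :: "('k::field \<Rightarrow> 'a::ab_group_add \<Rightarrow> 'a) \<Rightarrow> ('a \<Rightarrow> 'a \<Rightarrow> 'a) \<Rightarrow> 'a set \<Rightarrow> bool" where
  "finitely_generated sc br A \<longleftrightarrow> (\<exists>X. finite X \<and> X \<subseteq> A \<and> lie_generated sc br A X = A)"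

definition bracket_span :: "('k::field \<Rightarrow> 'a::ab_group_add \<Rightarrow> 'a) \<Rightarrow> ('a \<Rightarrow> 'a \<Rightarrow> 'a) \<Rightarrow> 'a set \<Rightarrow> 'a set \<Rightarrow> 'a set" where
  "bracket_span sc br X Y = module.span sc {br x y | x y. x \<in> X \<and> y \<in> Y}"

primrec lower_central :: "('k::field \<Rightarrow> 'a::ab_group_add \<Rightarrow> 'a) \<Rightarrow> ('a \<Rightarrow> 'a \<Rightarrow> 'a) \<Rightarrow> 'a set \<Rightarrow> nat \<Rightarrow> 'a set" where
  "lower_central sc br J 0 = J"
| "lower_central sc br J (Suc n) = bracket_span sc br (lower_central sc br J n) J"

definition nilpotent_ideal :: "('k::field \<Rightarrow> 'a::ab_group_add \<Rightarrow> 'a) \<Rightarrow> ('a \<Rightarrow> 'a \<Rightarrow> 'a) \<Rightarrow> 'a set \<Rightarrow> 'a set \<Rightarrow> bool" where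
  "nilpotent_ideal sc br A J \<longleftrightarrow> lie_ideal sc br A J \<and> (\<exists>n. lower_central sc br J n = {0})"

definition fitting :: "('k::field \<Rightarrow> 'a::ab_group_add \<Rightarrow> 'a) \<Rightarrow> ('a \<Rightarrow> 'a \<Rightarrow> 'a) \<Rightarrow> 'a set \<Rightarrow> 'a set" where
  "fitting sc br A = \<Inter>{I. lie_ideal sc br A I \<and> \<Union>{J. nilpotent_ideal sc br A J} \<subseteq> I}"

definition metabelian :: "('k::field \<Rightarrow> 'a::ab_group_add \<Rightarrow> 'a) \<Rightarrow> ('a \<Rightarrow> 'a \<Rightarrow> 'a) \<Rightarrow> 'a set \<Rightarrow> bool" where
  "metabelian sc br A \<longleftrightarrow> lie_algebra sc br A
     \<and> (\<forall>a\<in>A. \<forall>b\<in>A. \<forall>c\<in>A. \<forall>d\<in>A. br (br a b) (br c d) = 0)"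

definition abelian_set :: "('a \<Rightarrow> 'a \<Rightarrow> 'a::zero) \<Rightarrow> 'a set \<Rightarrow> bool" where
  "abelian_set br J \<longleftrightarrow> (\<forall>x\<in>J. \<forall>y\<in>J. br x y = 0)"

type_synonym ('v, 'k) mpoly = "('v \<Rightarrow>\<^sub>0 nat) \<Rightarrow>\<^sub>0 'k"

definition polys_in :: "'v set \<Rightarrow> ('v, 'k::zero) mpoly set" where
  "polys_in V = {p. \<forall>m\<in>Poly_Mapping.keys p. Poly_Mapping.keys m \<subseteq> V}"

definition pvar :: "'v \<Rightarrow> ('v, 'k::{zero,one}) mpoly" where
  "pvar v = Poly_Mapping.single (Poly_Mapping.single v 1) 1"

definition pconst :: "'k::zero \<Rightarrow> ('v, 'k) mpoly" where
  "pconst c = Poly_Mapping.single 0 c"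

definition quotient_basis :: "('k::field \<Rightarrow> 'a::ab_group_add \<Rightarrow> 'a) \<Rightarrow> 'a set \<Rightarrow> 'a set \<Rightarrow> 'a set \<Rightarrow> bool" where
  "quotient_basis sc A J B \<longleftrightarrow> B \<subseteq> A \<and> A \<subseteq> module.span sc (B \<union> J)
     \<and> (\<forall>B' c. finite B' \<longrightarrow> B' \<subseteq> B \<longrightarrow> (\<Sum>b\<in>B'. sc (c b) b) \<in> J \<longrightarrow> (\<forall>b\<in>B'. c b = 0))"

definition poly_action :: "('k::field \<Rightarrow> 'a::ab_group_add \<Rightarrow> 'a) \<Rightarrow> ('a \<Rightarrow> 'a \<Rightarrow> 'a) \<Rightarrow> 'a set \<Rightarrow> 'a set
      \<Rightarrow> ('a \<Rightarrow> ('a, 'k) mpoly \<Rightarrow> 'a) \<Rightarrow> bool" where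
  "poly_action sc br J B act \<longleftrightarrow>
     (\<forall>v\<in>J. \<forall>f\<in>polys_in B. act v f \<in> J)
   \<and> (\<forall>v\<in>J. act v 1 = v)
   \<and> (\<forall>v\<in>J. \<forall>b\<in>B. act v (pvar b) = br v b)
   \<and> (\<forall>v\<in>J. \<forall>f\<in>polys_in B. \<forall>g\<in>polys_in B. act v (f + g) = act v f + act v g)
   \<and> (\<forall>v\<in>J. \<forall>c. \<forall>f\<in>polys_in B. act v (pconst c * f) = sc c (act v f))
   \<and> (\<forall>v\<in>J. \<forall>w\<in>J. \<forall>f\<in>polys_in B. act (v + w) f = act v f + act w f)
   \<and> (\<forall>v\<in>J. \<forall>c. \<forall>f\<in>polys_in B. act (sc c v) f = sc c (act v f))
   \<and> (\<forall>v\<in>J. \<forall>f\<in>polys_in B. \<forall>g\<in>polys_in B. act v (f * g) = act (act v f) g)"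

definition torsion_free_action :: "'a::zero set \<Rightarrow> 'a set \<Rightarrow> ('a \<Rightarrow> ('a, 'k::zero) mpoly \<Rightarrow> 'a) \<Rightarrow> bool" where
  "torsion_free_action J B act \<longleftrightarrow> (\<forall>v\<in>J. \<forall>f\<in>polys_in B. act v f = 0 \<longrightarrow> v = 0 \<or> f = 0)"

text \<open>Metabelian Lie U-algebra. The R-module structure exists, and (it being independent of
  the choices) every such structure is torsion-free.\<close>
definition U_algebra :: "('k::field \<Rightarrow> 'a::ab_group_add \<Rightarrow> 'a) \<Rightarrow> ('a \<Rightarrow> 'a \<Rightarrow> 'a) \<Rightarrow> 'a set \<Rightarrow> bool" where
  "U_algebra sc br A \<longleftrightarrow> metabelian sc br A \<and> abelian_set br (fitting sc br A)
     \<and> (\<exists>B act. quotient_basis sc A (fitting sc br A) B \<and> poly_action sc br (fitting sc br A) B act)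
     \<and> (\<forall>B act. quotient_basis sc A (fitting sc br A) B \<and> poly_action sc br (fitting sc br A) B act
           \<longrightarrow> torsion_free_action (fitting sc br A) B act)"

definition lie_embedding :: "('k::field \<Rightarrow> 'a::ab_group_add \<Rightarrow> 'a) \<Rightarrow> ('a \<Rightarrow> 'a \<Rightarrow> 'a) \<Rightarrow> 'a set
      \<Rightarrow> ('k \<Rightarrow> 'b::ab_group_add \<Rightarrow> 'b) \<Rightarrow> ('b \<Rightarrow> 'b \<Rightarrow> 'b) \<Rightarrow> ('a \<Rightarrow> 'b) \<Rightarrow> bool" where
  "lie_embedding sc1 br1 A sc2 br2 \<phi> \<longleftrightarrow> inj_on \<phi> A
     \<and> (\<forall>x\<in>A. \<forall>y\<in>A. \<phi> (x + y) = \<phi> x + \<phi> y)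
     \<and> (\<forall>c. \<forall>x\<in>A. \<phi> (sc1 c x) = sc2 c (\<phi> x))
     \<and> (\<forall>x\<in>A. \<forall>y\<in>A. \<phi> (br1 x y) = br2 (\<phi> x) (\<phi> y))"

text \<open>(f,u) with f in R = k[x_alpha], u in T = free R-module with basis u_i (i in I),
  represented as finitely supported functions I -> R.\<close>
type_synonym ('i, 'l, 'k) mat_elem = "('l, 'k) mpoly \<times> ('i \<Rightarrow>\<^sub>0 ('l, 'k) mpoly)"

definition mat_scale :: "'k::field \<Rightarrow> ('i, 'l, 'k) mat_elem \<Rightarrow> ('i, 'l, 'k) mat_elem" where
  "mat_scale c p = (pconst c * fst p, Poly_Mapping.map (\<lambda>r. pconst c * r) (snd p))"

definition mat_br :: "('i, 'l, 'k::field) mat_elem \<Rightarrow> ('i, 'l, 'k) mat_elem \<Rightarrow> ('i, 'l, 'k) mat_elem" where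
  "mat_br p q = (0, Poly_Mapping.map (\<lambda>r. r * fst q) (snd p) - Poly_Mapping.map (\<lambda>r. r * fst p) (snd q))"

definition matM :: "'i set \<Rightarrow> 'l set \<Rightarrow> ('i, 'l, 'k::field) mat_elem set" where
  "matM I \<Lambda> = {p. fst p \<in> polys_in \<Lambda> \<and> Poly_Mapping.keys (snd p) \<subseteq> I
                  \<and> (\<forall>i. Poly_Mapping.lookup (snd p) i \<in> polys_in \<Lambda>)}"

definition matM0 :: "'i set \<Rightarrow> 'l set \<Rightarrow> ('i, 'l, 'k::field) mat_elem set" where
  "matM0 I \<Lambda> = {p \<in> matM I \<Lambda>. \<forall>m\<in>Poly_Mapping.keys (fst p). \<exists>\<alpha>\<in>\<Lambda>. m = Poly_Mapping.single \<alpha> 1}"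

end

theory Submission
  imports Defs
begin

text \<open>
  A subalgebra \<open>T\<close> of the matrix algebra has the abelian ideal \<open>T\<^sub>0\<close> of matrices with vanishing
  upper left entry. If \<open>T\<^sub>0 = 0\<close> then \<open>T\<close> is abelian; otherwise \<open>T\<^sub>0\<close> is the Fitting radical, and a
  polynomial \<open>f\<close> in the elements of a basis of \<open>T / T\<^sub>0\<close> acts on it as multiplication by the polynomial
  obtained by substituting upper left entries. These are linearly independent linear forms, so the
  substitution is injective and the action torsion-free.

  Conversely, let \<open>F\<close> be the Fitting radical of a finitely generated U-algebra \<open>A\<close>, let \<open>\<pi> a\<close> be the
  linear form of the coordinates of \<open>a\<close> modulo \<open>F\<close>, and let \<open>b\<close> be one of the basis elements. The
  ideal of products is a finitely generated torsion-free module, so it has an embedding \<open>\<psi>\<close> into a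
  free module of finite rank. Then \<open>a \<mapsto> (\<pi> a, \<psi> (a \<circ> b))\<close> is the required embedding: it respects
  products by the Jacobi identity, and it is injective because \<open>a \<circ> b = a \<cdot> x\<^sub>b\<close> for \<open>a \<in> F\<close>.
  If \<open>A = F\<close> there is no such \<open>b\<close>, and \<open>\<psi>\<close> is applied to \<open>A\<close> itself.
\<close>

section \<open>Polynomials in a set of variables\<close>

lemma lookup_pconst_mult:
  "Poly_Mapping.lookup (pconst c * p) m = c * Poly_Mapping.lookup p m"
  for p :: "('v, 'k::field) mpoly"
  unfolding pconst_def mult_map_scale_conv_mult [symmetric]
  by (simp add: Poly_Mapping.map.rep_eq when_def)

lemma pconst_0 [simp]: "pconst 0 = 0"
  by (simp add: pconst_def)

lemma pconst_1 [simp]: "pconst 1 = 1"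
  by (simp add: pconst_def)

lemma pconst_add: "pconst (a + b) = pconst a + pconst b"
  by (simp add: pconst_def single_add)

lemma pconst_mult: "pconst (a * b) = pconst a * (pconst b :: ('v, 'k::field) mpoly)"
  by (simp add: pconst_def mult_single)

lemma vector_space_pconst_mult:
  "vector_space (\<lambda>c (p :: ('v, 'k::field) mpoly). pconst c * p)"
  by unfold_locales (simp_all add: distrib_left pconst_add distrib_right pconst_mult mult.assoc)

lemma single_eq_pconst_mult:
  "Poly_Mapping.single m c = pconst c * (Poly_Mapping.single m 1 :: ('v, 'k::field) mpoly)"
  by (simp add: pconst_def mult_single)

lemma poly_mapping_as_sum:
  "p = (\<Sum>m\<in>Poly_Mapping.keys p. Poly_Mapping.single m (Poly_Mapping.lookup p m))"
  for p :: "'a \<Rightarrow>\<^sub>0 'b::comm_monoid_add"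
proof (rule poly_mapping_eqI)
  fix k
  show "Poly_Mapping.lookup p k = Poly_Mapping.lookup
    (\<Sum>m\<in>Poly_Mapping.keys p. Poly_Mapping.single m (Poly_Mapping.lookup p m)) k"
    by (cases "k \<in> Poly_Mapping.keys p")
      (simp_all add: lookup_sum lookup_single when_def in_keys_iff)
qed

lemma poly_mapping_sum_induct [case_names zero single add]:
  fixes p :: "'a \<Rightarrow>\<^sub>0 'b::comm_monoid_add"
  assumes "P 0"
    and "\<And>m. m \<in> Poly_Mapping.keys p \<Longrightarrow> P (Poly_Mapping.single m (Poly_Mapping.lookup p m))"
    and "\<And>q r. P q \<Longrightarrow> P r \<Longrightarrow> P (q + r)"
  shows "P p"
proof -
  have "P (\<Sum>m\<in>M. Poly_Mapping.single m (Poly_Mapping.lookup p m))"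
    if "M \<subseteq> Poly_Mapping.keys p" for M
    using finite_subset [OF that finite_keys] that
    by (induction M rule: finite_induct) (auto intro: assms)
  then show ?thesis
    by (metis poly_mapping_as_sum order_refl)
qed

lemma polys_in_0 [simp]: "0 \<in> polys_in V"
  by (simp add: polys_in_def)

lemma polys_in_1 [simp]: "(1 :: ('v, 'k::field) mpoly) \<in> polys_in V"
  by (simp add: polys_in_def)

lemma polys_in_pconst [simp]: "pconst c \<in> polys_in V"
  by (simp add: polys_in_def pconst_def)

lemma polys_in_pvar [simp]: "v \<in> V \<Longrightarrow> (pvar v :: ('v, 'k::field) mpoly) \<in> polys_in V"
  by (simp add: polys_in_def pvar_def)

lemma polys_in_add [simp]:
  "p \<in> polys_in V \<Longrightarrow> q \<in> polys_in V \<Longrightarrow> p + q \<in> polys_in V"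
  for p q :: "('v, 'k::field) mpoly"
  using keys_add [of p q] by (fastforce simp: polys_in_def)

lemma polys_in_mult [simp]:
  fixes p q :: "('v, 'k::field) mpoly"
  assumes "p \<in> polys_in V" "q \<in> polys_in V"
  shows "p * q \<in> polys_in V"
proof -
  have "Poly_Mapping.keys m \<subseteq> V" if m: "m \<in> Poly_Mapping.keys (p * q)" for m
  proof -
    obtain a b where "m = a + b" "a \<in> Poly_Mapping.keys p" "b \<in> Poly_Mapping.keys q"
      using keys_mult [of p q] m by blast
    then show ?thesis
      using assms keys_add [of a b] by (fastforce simp: polys_in_def)
  qed
  then show ?thesis
    by (simp add: polys_in_def)
qed

lemma polys_in_uminus [simp]: "p \<in> polys_in V \<Longrightarrow> - p \<in> polys_in V"
  for p :: "('v, 'k::field) mpoly"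
  by (simp add: polys_in_def in_keys_iff)

lemma polys_in_diff [simp]: "p \<in> polys_in V \<Longrightarrow> q \<in> polys_in V \<Longrightarrow> p - q \<in> polys_in V"
  for p q :: "('v, 'k::field) mpoly"
  using polys_in_add [of p V "- q"] by simp

lemma polys_in_sum [simp]:
  "(\<And>i. i \<in> I \<Longrightarrow> f i \<in> polys_in V) \<Longrightarrow> sum f I \<in> polys_in V"
  for f :: "'i \<Rightarrow> ('v, 'k::field) mpoly"
  by (induction I rule: infinite_finite_induct) auto

lemma polys_in_prod [simp]:
  "(\<And>i. i \<in> I \<Longrightarrow> f i \<in> polys_in V) \<Longrightarrow> prod f I \<in> polys_in V"
  for f :: "'i \<Rightarrow> ('v, 'k::field) mpoly"
  by (induction I rule: infinite_finite_induct) auto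

lemma polys_in_empty: "p \<in> polys_in {} \<Longrightarrow> p = pconst (Poly_Mapping.lookup p 0)"
  for p :: "('v, 'k::field) mpoly"
  by (rule poly_mapping_eqI)
    (auto simp: polys_in_def pconst_def lookup_single when_def in_keys_iff)

text \<open>Induction on the total degree of \<open>m\<close>: dividing by one of its variables
  lowers the degree by 1. The coefficient stays in the constant at the bottom, so every step is
  multiplication by a single variable.\<close>

lemma single_monomial_induct:
  fixes P :: "('v, 'k::field) mpoly \<Rightarrow> bool"
  assumes "Poly_Mapping.keys m \<subseteq> V" and "P (pconst c)"
    and "\<And>p v. p \<in> polys_in V \<Longrightarrow> P p \<Longrightarrow> v \<in> V \<Longrightarrow> P (p * pvar v)"
  shows "P (Poly_Mapping.single m c)"
proof -
  have "P (Poly_Mapping.single m c)"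
    if "(\<Sum>v\<in>Poly_Mapping.keys m. Poly_Mapping.lookup m v) = n" "Poly_Mapping.keys m \<subseteq> V" for n m
    using that
  proof (induction n arbitrary: m)
    case 0
    then have "m = 0"
      by (intro poly_mapping_eqI) (auto simp: in_keys_iff)
    then show ?case
      using assms(2) by (simp add: pconst_def)
  next
    case (Suc n)
    then obtain v where v: "v \<in> Poly_Mapping.keys m"
      by (metis all_not_in_conv sum.empty nat.distinct(1))
    \<comment> \<open>Subtraction of exponents is truncated, but \<open>v\<close> occurs in
      \<open>m\<close>, so adding it back recovers \<open>m\<close>.\<close>
    define m' where "m' = m - Poly_Mapping.single v 1"
    have m: "m = m' + Poly_Mapping.single v 1"
      using v by (intro poly_mapping_eqI)
        (auto simp: m'_def lookup_add lookup_minus lookup_single when_def in_keys_iff)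
    have sub: "Poly_Mapping.keys m' \<subseteq> Poly_Mapping.keys m"
      by (auto simp: m'_def in_keys_iff lookup_minus)
    have "(\<Sum>v\<in>Poly_Mapping.keys m'. Poly_Mapping.lookup m' v)
        = (\<Sum>v\<in>Poly_Mapping.keys m. Poly_Mapping.lookup m' v)"
      by (rule sum.mono_neutral_left) (use sub in \<open>auto simp: in_keys_iff\<close>)
    moreover have "Suc n = (\<Sum>u\<in>Poly_Mapping.keys m. Poly_Mapping.lookup m' u + (if u = v then 1 else 0))"
      unfolding Suc.prems(1) [symmetric]
      by (rule sum.cong) (simp, subst (1) m, simp add: lookup_add lookup_single when_def)
    ultimately have "(\<Sum>v\<in>Poly_Mapping.keys m'. Poly_Mapping.lookup m' v) = n"
      using v by (simp add: sum.distrib)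
    with Suc sub have "P (Poly_Mapping.single m' c)"
      by blast
    moreover have "Poly_Mapping.single m c = Poly_Mapping.single m' c * pvar v"
      by (subst m) (simp add: pvar_def mult_single)
    moreover have "Poly_Mapping.single m' c \<in> polys_in V"
      using sub Suc.prems(2) by (auto simp: polys_in_def)
    ultimately show ?case
      using assms(3) v Suc.prems(2) by auto
  qed
  then show ?thesis
    using assms(1) by blast
qed

text \<open>The three cases are the ways in which a module action is determined: constants act by
  scaling, sums additively, and a further factor \<open>pvar v\<close> by one more bracket.\<close>

lemma polys_in_induct [consumes 1, case_names const add mult_var]:
  fixes P :: "('v, 'k::field) mpoly \<Rightarrow> bool"
  assumes p: "p \<in> polys_in V" and const: "\<And>c. P (pconst c)"
    and add: "\<And>p q. p \<in> polys_in V \<Longrightarrow> q \<in> polys_in V \<Longrightarrow> P p \<Longrightarrow> P q \<Longrightarrow> P (p + q)"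
    and mult: "\<And>p v. p \<in> polys_in V \<Longrightarrow> P p \<Longrightarrow> v \<in> V \<Longrightarrow> P (p * pvar v)"
  shows "P p"
proof -
  \<comment> \<open>Membership is carried along because the hypothesis on sums presupposes it for
    both summands.\<close>
  have "p \<in> polys_in V \<and> P p"
  proof (induction p rule: poly_mapping_sum_induct)
    case zero
    then show ?case
      using const [of 0] by simp
  next
    case (single m)
    then have "Poly_Mapping.keys m \<subseteq> V"
      using p by (auto simp: polys_in_def)
    then show ?case
      using single_monomial_induct [where P = P, OF _ const mult] by (auto simp: polys_in_def)
  next
    case (add q r)
    then show ?case
      by (auto intro: assms(3))
  qed
  then show ?thesis ..
qed

section \<open>Substitution homomorphisms between polynomial rings\<close>

definition poly_subst :: "('v \<Rightarrow> ('w, 'k) mpoly) \<Rightarrow> ('v, 'k::field) mpoly \<Rightarrow> ('w, 'k) mpoly" where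
  "poly_subst \<sigma> p = (\<Sum>m\<in>Poly_Mapping.keys p. pconst (Poly_Mapping.lookup p m)
     * (\<Prod>v\<in>Poly_Mapping.keys m. \<sigma> v ^ Poly_Mapping.lookup m v))"

lemma monomial_subst_superset:
  assumes "finite V" "Poly_Mapping.keys m \<subseteq> V"
  shows "(\<Prod>v\<in>Poly_Mapping.keys m. \<sigma> v ^ Poly_Mapping.lookup m v)
    = (\<Prod>v\<in>V. (\<sigma> v :: 'b::comm_semiring_1) ^ Poly_Mapping.lookup m v)"
  by (rule prod.mono_neutral_left) (use assms in \<open>auto simp: in_keys_iff\<close>)

lemma monomial_subst_add:
  "(\<Prod>v\<in>Poly_Mapping.keys (m + n). \<sigma> v ^ Poly_Mapping.lookup (m + n) v)
    = (\<Prod>v\<in>Poly_Mapping.keys m. \<sigma> v ^ Poly_Mapping.lookup m v)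
      * (\<Prod>v\<in>Poly_Mapping.keys n. (\<sigma> v :: 'b::comm_semiring_1) ^ Poly_Mapping.lookup n v)"
proof -
  define V where "V = Poly_Mapping.keys m \<union> Poly_Mapping.keys n"
  have V: "finite V" "Poly_Mapping.keys m \<subseteq> V" "Poly_Mapping.keys n \<subseteq> V"
      "Poly_Mapping.keys (m + n) \<subseteq> V"
    using keys_add [of m n] by (auto simp: V_def)
  show ?thesis
    unfolding monomial_subst_superset [OF V(1,2)] monomial_subst_superset [OF V(1,3)]
      monomial_subst_superset [OF V(1,4)]
    by (simp add: lookup_add power_add prod.distrib)
qed

text \<open>Over a common finite index set the coefficients of \<open>p\<close>, \<open>q\<close>
  and \<open>p + q\<close> can be added term by term, even though cancellation may shrink the
  support of \<open>p + q\<close>.\<close>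

lemma poly_subst_superset:
  assumes "finite M" "Poly_Mapping.keys p \<subseteq> M"
  shows "poly_subst \<sigma> p = (\<Sum>m\<in>M. pconst (Poly_Mapping.lookup p m)
     * (\<Prod>v\<in>Poly_Mapping.keys m. \<sigma> v ^ Poly_Mapping.lookup m v))"
  unfolding poly_subst_def
  by (rule sum.mono_neutral_left) (use assms in \<open>auto simp: in_keys_iff\<close>)

lemma poly_subst_add: "poly_subst \<sigma> (p + q) = poly_subst \<sigma> p + poly_subst \<sigma> q"
proof -
  define M where "M = Poly_Mapping.keys p \<union> Poly_Mapping.keys q"
  have M: "finite M" "Poly_Mapping.keys p \<subseteq> M" "Poly_Mapping.keys q \<subseteq> M"
      "Poly_Mapping.keys (p + q) \<subseteq> M"
    using keys_add [of p q] by (auto simp: M_def)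
  show ?thesis
    unfolding poly_subst_superset [OF M(1,2)] poly_subst_superset [OF M(1,3)]
      poly_subst_superset [OF M(1,4)]
    by (simp add: lookup_add pconst_add distrib_right sum.distrib)
qed

lemma poly_subst_0 [simp]: "poly_subst \<sigma> 0 = 0"
  by (simp add: poly_subst_def)

lemma poly_subst_single:
  "poly_subst \<sigma> (Poly_Mapping.single m c)
    = pconst c * (\<Prod>v\<in>Poly_Mapping.keys m. \<sigma> v ^ Poly_Mapping.lookup m v)"
  by (cases "c = 0") (simp_all add: poly_subst_def)

lemma poly_subst_pconst [simp]: "poly_subst \<sigma> (pconst c) = pconst c"
  by (simp add: pconst_def poly_subst_single)

lemma poly_subst_1 [simp]: "poly_subst \<sigma> 1 = 1"
  using poly_subst_pconst [of \<sigma> 1] by simp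

lemma poly_subst_pvar [simp]: "poly_subst \<sigma> (pvar v) = \<sigma> v"
  by (simp add: pvar_def poly_subst_single)

text \<open>Both sides are additive in each factor, so two nested inductions reduce the claim to a
  product of two monomials, where exponents add.\<close>

lemma poly_subst_mult: "poly_subst \<sigma> (p * q) = poly_subst \<sigma> p * poly_subst \<sigma> q"
proof (induction p rule: poly_mapping_sum_induct)
  case (single m)
  show ?case
  proof (induction q rule: poly_mapping_sum_induct)
    case (single n)
    show ?case
      by (simp add: mult_single poly_subst_single monomial_subst_add pconst_mult mult_ac)
  qed (simp_all add: distrib_left poly_subst_add)
qed (simp_all add: distrib_right poly_subst_add)

lemma poly_subst_sum: "poly_subst \<sigma> (sum f I) = (\<Sum>i\<in>I. poly_subst \<sigma> (f i))"
  by (induction I rule: infinite_finite_induct) (simp_all add: poly_subst_add)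

lemma poly_subst_poly_subst:
  assumes "p \<in> polys_in V" "\<And>v. v \<in> V \<Longrightarrow> poly_subst \<tau> (\<sigma> v) = \<rho> v"
  shows "poly_subst \<tau> (poly_subst \<sigma> p) = poly_subst \<rho> p"
  using assms(1) by (induction rule: polys_in_induct)
    (simp_all add: poly_subst_add poly_subst_mult assms(2))

lemma poly_subst_pvar_id: "p \<in> polys_in V \<Longrightarrow> poly_subst pvar p = p"
  by (induction rule: polys_in_induct) (simp_all add: poly_subst_add poly_subst_mult)

lemma poly_subst_left_inverse:
  assumes "p \<in> polys_in V" "\<And>v. v \<in> V \<Longrightarrow> poly_subst \<tau> (\<sigma> v) = pvar v"
  shows "poly_subst \<tau> (poly_subst \<sigma> p) = p"
  using poly_subst_poly_subst [OF assms] poly_subst_pvar_id [OF assms(1)] by simp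

section \<open>Zero divisors and algebraic independence\<close>

lemma poly_subst_rename_eq_0_iff:
  assumes "p \<in> polys_in V" "inj_on h V"
  shows "poly_subst (\<lambda>v. pvar (h v)) p = 0 \<longleftrightarrow> p = 0"
proof -
  \<comment> \<open>Renaming back along the inverse of \<open>h\<close> on \<open>V\<close> is again
    a substitution and undoes the first one.\<close>
  have "poly_subst (\<lambda>w. pvar (inv_into V h w)) (poly_subst (\<lambda>v. pvar (h v)) p) = p"
    by (rule poly_subst_left_inverse [OF assms(1)]) (simp add: assms(2))
  then show ?thesis
    by (metis poly_subst_0)
qed

text \<open>The library provides this only for linearly ordered monomials; only finitely many variables
  occur in \<open>p\<close> and \<open>q\<close>, so they can be renamed to natural numbers.\<close>

lemma mpoly_mult_eq_0_iff: "p * q = 0 \<longleftrightarrow> p = 0 \<or> q = 0" for p q :: "('v, 'k::field) mpoly"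
proof -
  define V where "V = (\<Union>m\<in>Poly_Mapping.keys p \<union> Poly_Mapping.keys q. Poly_Mapping.keys m)"
  have "finite V"
    by (simp add: V_def)
  then obtain h :: "'v \<Rightarrow> nat" where h: "inj_on h V"
    using finite_imp_inj_to_nat_seg by blast
  have pq: "p \<in> polys_in V" "q \<in> polys_in V"
    by (auto simp: V_def polys_in_def)
  let ?r = "poly_subst (\<lambda>v. pvar (h v))"
  have "p = 0 \<or> q = 0" if "p * q = 0"
  proof -
    have "?r p * ?r q = 0"
      by (metis that poly_subst_mult poly_subst_0)
    then have "?r p = 0 \<or> ?r q = 0"
      by simp
    then show ?thesis
      using poly_subst_rename_eq_0_iff [OF _ h] pq by blast
  qed
  then show ?thesis
    by auto
qed

lemma mpoly_prod_eq_0: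
  "finite I \<Longrightarrow> prod f I = 0 \<Longrightarrow> \<exists>i\<in>I. f i = 0" for f :: "'i \<Rightarrow> ('v, 'k::field) mpoly"
  by (induction I rule: finite_induct) (auto simp: mpoly_mult_eq_0_iff)

text \<open>On linear combinations of variables a substitution is determined by
  \<open>k\<close>-linearity and its values on the variables. A linear map \<open>g\<close> obtained
  from linear algebra thus agrees there with a ring homomorphism.\<close>

lemma poly_subst_eq_linear:
  fixes g :: "('l, 'k::field) mpoly \<Rightarrow> ('w, 'k) mpoly"
  assumes add: "\<And>p q. g (p + q) = g p + g q" and scale: "\<And>c p. g (pconst c * p) = pconst c * g p"
    and "\<forall>m\<in>Poly_Mapping.keys p. \<exists>\<alpha>. m = Poly_Mapping.single \<alpha> 1"
  shows "poly_subst (\<lambda>\<alpha>. g (pvar \<alpha>)) p = g p"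
proof (induction p rule: poly_mapping_sum_induct)
  case zero
  show ?case
    using scale [of 0 0] by simp
next
  case (single m)
  then obtain \<alpha> where "m = Poly_Mapping.single \<alpha> 1"
    using assms(3) by blast
  then have "Poly_Mapping.single m (Poly_Mapping.lookup p m)
      = pconst (Poly_Mapping.lookup p m) * pvar \<alpha>"
    by (metis pvar_def single_eq_pconst_mult)
  then show ?case
    by (simp add: poly_subst_mult scale)
qed (simp add: poly_subst_add add)

text \<open>Linearly independent linear forms are algebraically independent: a linear map that sends them
  to variables induces a substitution, which inverts the given one.\<close>

lemma poly_subst_independent_linear_forms:
  fixes \<sigma> :: "'v \<Rightarrow> ('l, 'k::field) mpoly"
  assumes lin: "\<And>b. b \<in> B \<Longrightarrow> \<forall>m\<in>Poly_Mapping.keys (\<sigma> b). \<exists>\<alpha>. m = Poly_Mapping.single \<alpha> 1"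
    and indep: "\<And>B' c. finite B' \<Longrightarrow> B' \<subseteq> B \<Longrightarrow> (\<Sum>b\<in>B'. pconst (c b) * \<sigma> b) = 0 \<Longrightarrow> \<forall>b\<in>B'. c b = 0"
    and p: "p \<in> polys_in B" "poly_subst \<sigma> p = 0"
  shows "p = 0"
proof -
  interpret P: vector_space_pair "\<lambda>c (p :: ('l, 'k) mpoly). pconst c * p"
      "\<lambda>c (p :: ('v, 'k) mpoly). pconst c * p"
    by (intro vector_space_pair.intro vector_space_pconst_mult)
  \<comment> \<open>Equal forms at two different elements would satisfy a relation with coefficients
    1 and -1. Injectivity allows relations over the set of forms to be reindexed by elements of
    \<open>B\<close>.\<close>
  have inj: "inj_on \<sigma> B"
  proof (rule inj_onI, rule ccontr)
    fix b b' assume b: "b \<in> B" "b' \<in> B" "\<sigma> b = \<sigma> b'" "b \<noteq> b'"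
    have "(pconst 1 + pconst (- 1)) * \<sigma> b' = 0"
      unfolding pconst_add [symmetric] by simp
    with b have "(\<Sum>x\<in>{b, b'}. pconst (if x = b then 1 else - 1) * \<sigma> x) = 0"
      by (simp add: distrib_right)
    then show False
      using indep [of "{b, b'}" "\<lambda>x. if x = b then 1 else - 1"] b by auto
  qed
  have "P.vs1.independent (\<sigma> ` B)"
    unfolding P.vs1.dependent_explicit
  proof clarify
    fix t u x assume t: "finite t" "t \<subseteq> \<sigma> ` B" "(\<Sum>v\<in>t. pconst (u v) * v) = 0" "x \<in> t" "u x \<noteq> 0"
    then obtain B' where B': "B' \<subseteq> B" "t = \<sigma> ` B'"
      by (meson subset_imageE)
    with inj have inj': "inj_on \<sigma> B'"
      by (blast intro: inj_on_subset)
    have "(\<Sum>b\<in>B'. pconst (u (\<sigma> b)) * \<sigma> b) = 0"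
      using t(3) by (simp add: B'(2) sum.reindex [OF inj'])
    moreover have "finite B'"
      using t(1) B' inj' by (simp add: finite_image_iff)
    ultimately have "\<forall>b\<in>B'. u (\<sigma> b) = 0"
      using B'(1) indep [of B' "\<lambda>b. u (\<sigma> b)"] by simp
    with B'(2) t(4,5) show False
      by auto
  qed
  then obtain g where g: "Vector_Spaces.linear (\<lambda>c p. pconst c * p) (\<lambda>c p. pconst c * p) g"
      "\<forall>x\<in>\<sigma> ` B. g x = pvar (inv_into B \<sigma> x)"
    using P.linear_independent_extend by meson
  interpret g: Vector_Spaces.linear "\<lambda>c (p :: ('l, 'k) mpoly). pconst c * p"
      "\<lambda>c (p :: ('v, 'k) mpoly). pconst c * p" g
    by (rule g)
  have "poly_subst (\<lambda>\<alpha>. g (pvar \<alpha>)) (poly_subst \<sigma> p) = p"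
  proof (rule poly_subst_left_inverse [OF p(1)])
    fix b assume "b \<in> B"
    then show "poly_subst (\<lambda>\<alpha>. g (pvar \<alpha>)) (\<sigma> b) = pvar b"
      using poly_subst_eq_linear [OF g.add g.scale lin] g(2) inj by simp
  qed
  then show ?thesis
    using p(2) by simp
qed

section \<open>Ideals and the Fitting radical\<close>

lemma abelian_ideal_nilpotent:
  assumes "vector_space sc" "lie_ideal sc br A J" "abelian_set br J"
  shows "nilpotent_ideal sc br A J"
proof -
  interpret vector_space sc
    by (rule assms)
  have "{br x y | x y. x \<in> J \<and> y \<in> J} \<subseteq> {0}"
    using assms(3) by (auto simp: abelian_set_def)
  then have "lower_central sc br J 1 \<subseteq> span {0}"
    by (simp add: bracket_span_def span_mono del: span_insert_0)
  then have "lower_central sc br J 1 = {0}"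
    using span_zero by (auto simp: bracket_span_def)
  then show ?thesis
    using assms(2) unfolding nilpotent_ideal_def by blast
qed

lemma nilpotent_ideal_subset_fitting: "nilpotent_ideal sc br A J \<Longrightarrow> J \<subseteq> fitting sc br A"
  by (auto simp: fitting_def)

text \<open>A nilpotent ideal that contains all others is one of the ideals being intersected, and
  it lies inside each of them.\<close>

lemma fitting_eqI:
  assumes "nilpotent_ideal sc br A J" "\<And>K. nilpotent_ideal sc br A K \<Longrightarrow> K \<subseteq> J"
  shows "fitting sc br A = J"
proof
  show "fitting sc br A \<subseteq> J"
    unfolding fitting_def
  proof (rule Inter_lower, rule CollectI, rule conjI)
    show "lie_ideal sc br A J"
      using assms(1) by (simp add: nilpotent_ideal_def)
    show "\<Union>{K. nilpotent_ideal sc br A K} \<subseteq> J"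
      using assms(2) by blast
  qed
qed (rule nilpotent_ideal_subset_fitting [OF assms(1)])

lemma lie_ideal_self: "lie_algebra sc br A \<Longrightarrow> lie_ideal sc br A A"
  by (simp add: lie_algebra_def lie_ideal_def)

lemma lie_ideal_fitting:
  assumes "lie_algebra sc br A"
  shows "lie_ideal sc br A (fitting sc br A)"
proof -
  interpret vector_space sc
    using assms by (simp add: lie_algebra_def)
  have "subspace (fitting sc br A)"
    unfolding fitting_def by (rule subspace_Inter) (simp add: lie_ideal_def)
  moreover have "fitting sc br A \<subseteq> A"
    unfolding fitting_def
    by (rule Inter_lower) (use lie_ideal_self [OF assms] in \<open>auto simp: nilpotent_ideal_def lie_ideal_def\<close>)
  ultimately show ?thesis
    by (auto simp: fitting_def lie_ideal_def)
qed

text \<open>Each single \<open>b\<close> already lies in \<open>A\<close>, so the coefficient 1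
  contradicts independence modulo \<open>A\<close>.\<close>

lemma quotient_basis_self:
  assumes "quotient_basis sc A A B" "vector_space sc"
  shows "B = {}"
proof (rule equals0I)
  fix b assume b: "b \<in> B"
  interpret vector_space sc
    by (rule assms)
  have indep: "\<forall>B' c. finite B' \<longrightarrow> B' \<subseteq> B \<longrightarrow> (\<Sum>b\<in>B'. sc (c b) b) \<in> A \<longrightarrow> (\<forall>b\<in>B'. c b = 0)"
    and "b \<in> A"
    using assms(1) b unfolding quotient_basis_def by auto
  then show False
    using indep [rule_format, of "{b}" "\<lambda>_. 1" b] b by simp
qed

text \<open>A basis \<open>C\<close> of \<open>J\<close> is extended inside \<open>A\<close> to a
  basis \<open>D\<close> of \<open>A\<close>; the added vectors represent a basis of the
  quotient.\<close>

lemma exists_quotient_basis: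
  assumes "vector_space sc" "module.subspace sc J" "module.subspace sc A" "J \<subseteq> A"
  shows "\<exists>B. quotient_basis sc A J B"
proof -
  interpret vector_space sc
    by (rule assms)
  obtain C where C: "C \<subseteq> J" "independent C" "span C = J"
    using maximal_independent_subset [of J] assms(2) span_subspace by metis
  then obtain D where D: "C \<subseteq> D" "D \<subseteq> A" "independent D" "A \<subseteq> span D"
    using maximal_independent_subset_extend [of C A] assms(4) by blast
  have "c x = 0" if B': "finite B'" "B' \<subseteq> D - C" "(\<Sum>b\<in>B'. sc (c b) b) \<in> J" "x \<in> B'" for B' c x
  proof -
    let ?v = "\<Sum>b\<in>B'. sc (c b) b"
    have B'D: "b \<in> span D" if "b \<in> B'" for b
      using B'(2) that by (auto intro: span_base)
    \<comment> \<open>The coefficient \<open>c x\<close> is the coordinate of \<open>?v\<close> at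
      \<open>x\<close> with respect to \<open>D\<close>. Since \<open>?v\<close> lies in
      \<open>span C\<close> and \<open>x\<close> is outside \<open>C\<close>, this coordinate is
      0.\<close>
    have "representation D ?v x = (\<Sum>b\<in>B'. c b * representation D b x)"
      by (simp add: representation_sum [OF D(3)] representation_scale [OF D(3)] B'D span_scale)
    also have "\<dots> = (\<Sum>b\<in>B'. if b = x then c b else 0)"
      by (intro sum.cong) (use B'(2) in \<open>auto simp: representation_basis [OF D(3)]\<close>)
    also have "\<dots> = c x"
      using B' by simp
    finally have "representation D ?v x = c x" .
    moreover have "representation D ?v = representation C ?v"
      using representation_extend [OF D(3) _ D(1)] B'(3) C(3) by simp
    moreover have "representation C ?v x = 0"
      using representation_ne_zero [of C ?v x] B'(2,4) by auto
    ultimately show "c x = 0"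
      by simp
  qed
  moreover have "span D \<subseteq> span ((D - C) \<union> J)"
    by (rule span_mono) (use C in auto)
  ultimately have "quotient_basis sc A J (D - C)"
    unfolding quotient_basis_def using D by blast
  then show ?thesis ..
qed

section \<open>Subalgebras of the matrix algebra\<close>

lemma lookup_map_mult [simp]:
  "Poly_Mapping.lookup (Poly_Mapping.map (\<lambda>r. r * f) u) i = Poly_Mapping.lookup u i * f"
  for f :: "'b::mult_zero"
  by (simp add: Poly_Mapping.map.rep_eq when_def)

lemma lookup_map_pconst_mult [simp]:
  "Poly_Mapping.lookup (Poly_Mapping.map (\<lambda>r. pconst c * r) u) i = pconst c * Poly_Mapping.lookup u i"
  for u :: "'i \<Rightarrow>\<^sub>0 ('l, 'k::field) mpoly"
  by (simp add: Poly_Mapping.map.rep_eq when_def)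

lemma mat_eqI:
  "fst p = fst q \<Longrightarrow> (\<And>i. Poly_Mapping.lookup (snd p) i = Poly_Mapping.lookup (snd q) i) \<Longrightarrow> p = q"
  by (simp add: prod_eq_iff poly_mapping_eqI)

lemma fst_mat_scale [simp]: "fst (mat_scale c p) = pconst c * fst p"
  and lookup_mat_scale [simp]:
    "Poly_Mapping.lookup (snd (mat_scale c p)) i = pconst c * Poly_Mapping.lookup (snd p) i"
  by (simp_all add: mat_scale_def)

lemma fst_mat_br [simp]: "fst (mat_br p q) = 0"
  and lookup_mat_br [simp]: "Poly_Mapping.lookup (snd (mat_br p q)) i
    = Poly_Mapping.lookup (snd p) i * fst q - Poly_Mapping.lookup (snd q) i * fst p"
  by (simp_all add: mat_br_def lookup_minus)

lemma vector_space_mat_scale: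
  "vector_space (mat_scale :: 'k::field \<Rightarrow> ('i, 'l, 'k) mat_elem \<Rightarrow> ('i, 'l, 'k) mat_elem)"
  by unfold_locales
    (auto intro!: mat_eqI simp: lookup_add pconst_add pconst_mult algebra_simps)

lemma lie_algebra_mat:
  assumes "lie_subalgebra mat_scale mat_br M T"
  shows "lie_algebra mat_scale mat_br T"
  using assms unfolding lie_algebra_def lie_subalgebra_def
  by (auto intro!: mat_eqI vector_space_mat_scale simp: lookup_add algebra_simps)

lemma metabelian_mat:
  assumes "lie_subalgebra mat_scale mat_br M T"
  shows "metabelian mat_scale mat_br T"
  using lie_algebra_mat [OF assms] unfolding metabelian_def by (auto intro!: mat_eqI)

lemma lie_ideal_mat_fst_0:
  fixes T :: "('i, 'l, 'k::field) mat_elem set"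
  assumes "lie_subalgebra mat_scale mat_br M T"
  shows "lie_ideal mat_scale mat_br T {p \<in> T. fst p = 0}"
proof -
  interpret vector_space "mat_scale :: 'k \<Rightarrow> ('i, 'l, 'k) mat_elem \<Rightarrow> ('i, 'l, 'k) mat_elem"
    by (rule vector_space_mat_scale)
  show ?thesis
    using assms unfolding lie_ideal_def lie_subalgebra_def
    by (auto intro!: subspaceI intro: subspace_0 subspace_add subspace_scale)
qed

lemma abelian_mat_fst_0: "abelian_set mat_br {p \<in> T. fst p = 0}"
  by (auto simp: abelian_set_def intro!: mat_eqI)

text \<open>Repeated multiplication by an element of the ideal with nonzero upper left entry \<open>f\<close> acts on
  the elements \<open>(0, u)\<close> as multiplication by powers of \<open>f\<close>, which is injective.\<close>

lemma nilpotent_ideal_mat_subset: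
  fixes T :: "('i, 'l, 'k::field) mat_elem set"
  assumes T: "lie_subalgebra mat_scale mat_br M T" and t: "t \<in> T" "fst t = 0" "t \<noteq> 0"
    and K: "nilpotent_ideal mat_scale mat_br T K"
  shows "K \<subseteq> {p \<in> T. fst p = 0}"
proof -
  interpret vector_space "mat_scale :: 'k \<Rightarrow> ('i, 'l, 'k) mat_elem \<Rightarrow> ('i, 'l, 'k) mat_elem"
    by (rule vector_space_mat_scale)
  have KI: "K \<subseteq> T" "subspace K" "\<And>x a. x \<in> K \<Longrightarrow> a \<in> T \<Longrightarrow> mat_br x a \<in> K"
    using K by (auto simp: nilpotent_ideal_def lie_ideal_def)
  obtain n where n: "lower_central mat_scale mat_br K n = {0}"
    using K by (auto simp: nilpotent_ideal_def)
  obtain i where i: "Poly_Mapping.lookup (snd t) i \<noteq> 0"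
    using t(2,3) by (metis mat_eqI fst_zero snd_zero lookup_zero)
  have "fst q = 0" if q: "q \<in> K" for q
  proof (rule ccontr)
    assume f: "fst q \<noteq> 0"
    have "\<exists>w \<in> lower_central mat_scale mat_br K m. fst w = 0
        \<and> Poly_Mapping.lookup (snd w) i \<noteq> 0" for m
    proof (induction m)
      \<comment> \<open>As \<open>t\<close> itself may lie outside \<open>K\<close>, the start is
        \<open>mat_br q t\<close>, which is in \<open>K\<close> and has the entry of
        \<open>t\<close> at \<open>i\<close> multiplied by \<open>- fst q\<close>.\<close>
      case 0
      have "mat_br q t \<in> K"
        using KI q t by auto
      moreover have "Poly_Mapping.lookup (snd (mat_br q t)) i \<noteq> 0"
        using i f t by (simp add: mpoly_mult_eq_0_iff)
      ultimately show ?case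
        by (intro bexI [of _ "mat_br q t"]) simp_all
    next
      case (Suc m)
      then obtain w where w: "w \<in> lower_central mat_scale mat_br K m" "fst w = 0"
          "Poly_Mapping.lookup (snd w) i \<noteq> 0"
        by blast
      have "mat_br w q \<in> lower_central mat_scale mat_br K (Suc m)"
        unfolding lower_central.simps bracket_span_def by (rule span_base) (use w(1) q in blast)
      moreover have "Poly_Mapping.lookup (snd (mat_br w q)) i \<noteq> 0"
        using w f by (simp add: mpoly_mult_eq_0_iff)
      ultimately show ?case
        by (intro bexI [of _ "mat_br w q"]) simp_all
    qed
    from this [of n] show False
      by (simp add: n)
  qed
  then show ?thesis
    using KI(1) by blast
qed

section \<open>Polynomial actions: constants, and substitution on matrices\<close>

lemma poly_action_constants:
  assumes A: "lie_algebra sc br A"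
  shows "poly_action sc br A {} (\<lambda>v f. sc (Poly_Mapping.lookup f 0) v)"
proof -
  interpret vector_space sc
    using A by (simp add: lie_algebra_def)
  have "subspace A"
    using A by (simp add: lie_algebra_def)
  moreover have "Poly_Mapping.lookup (pconst c) 0 = c" for c :: 'a
    by (simp add: pconst_def)
  moreover have "Poly_Mapping.lookup (f * g) 0 = Poly_Mapping.lookup f 0 * Poly_Mapping.lookup g 0"
    if "f \<in> polys_in {}" for f g :: "('b, 'a) mpoly"
    by (subst polys_in_empty [OF that]) (rule lookup_pconst_mult)
  ultimately show ?thesis
    unfolding poly_action_def
    by (auto simp: lookup_pconst_mult lookup_add scale_left_distrib scale_right_distrib mult_ac
        intro: subspace_scale)
qed

lemma poly_actionD:
  assumes "poly_action sc br J B act"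
  shows "v \<in> J \<Longrightarrow> f \<in> polys_in B \<Longrightarrow> act v f \<in> J"
    and "v \<in> J \<Longrightarrow> act v 1 = v"
    and "v \<in> J \<Longrightarrow> b \<in> B \<Longrightarrow> act v (pvar b) = br v b"
    and "v \<in> J \<Longrightarrow> f \<in> polys_in B \<Longrightarrow> g \<in> polys_in B \<Longrightarrow> act v (f + g) = act v f + act v g"
    and "v \<in> J \<Longrightarrow> f \<in> polys_in B \<Longrightarrow> act v (pconst c * f) = sc c (act v f)"
    and "v \<in> J \<Longrightarrow> w \<in> J \<Longrightarrow> f \<in> polys_in B \<Longrightarrow> act (v + w) f = act v f + act w f"
    and "v \<in> J \<Longrightarrow> f \<in> polys_in B \<Longrightarrow> act (sc c v) f = sc c (act v f)"
    and "v \<in> J \<Longrightarrow> f \<in> polys_in B \<Longrightarrow> g \<in> polys_in B \<Longrightarrow> act v (f * g) = act (act v f) g"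
  using assms unfolding poly_action_def by blast+

lemma poly_action_pconst:
  assumes "poly_action sc br J B act" "v \<in> J"
  shows "act v (pconst c) = sc c v"
proof -
  have "act v (pconst c * 1) = sc c (act v 1)"
    by (rule poly_actionD [OF assms(1)]) (simp_all add: assms(2))
  then show ?thesis
    using poly_actionD(2) [OF assms] by simp
qed

text \<open>Without variables the ring is \<open>k\<close> and acts by scaling, so torsion-freeness
  is the vector space law that \<open>sc c v = 0\<close> forces \<open>c = 0\<close> or
  \<open>v = 0\<close>.\<close>

lemma torsion_free_constants:
  assumes "vector_space sc" "poly_action sc br A {} act"
  shows "torsion_free_action A {} act"
proof -
  interpret vector_space sc
    by (rule assms)
  show ?thesis
    unfolding torsion_free_action_def
    using poly_action_pconst [OF assms(2)] polys_in_empty by (metis scale_eq_0_iff pconst_0)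
qed

text \<open>The variables are named by matrices \<open>b\<close>, and \<open>fst\<close> substitutes
  for each its upper left entry. This fits the bracket: if \<open>fst v = 0\<close>, then
  \<open>mat_br v b\<close> multiplies the row of \<open>v\<close> by \<open>fst b\<close>.\<close>

definition mat_poly_act :: "('i, 'l, 'k::field) mat_elem \<Rightarrow> (('i, 'l, 'k) mat_elem, 'k) mpoly
    \<Rightarrow> ('i, 'l, 'k) mat_elem" where
  "mat_poly_act v f = (0, Poly_Mapping.map (\<lambda>r. r * poly_subst fst f) (snd v))"

lemma fst_mat_poly_act [simp]: "fst (mat_poly_act v f) = 0"
  and lookup_mat_poly_act [simp]: "Poly_Mapping.lookup (snd (mat_poly_act v f)) i
    = Poly_Mapping.lookup (snd v) i * poly_subst fst f"
  by (simp_all add: mat_poly_act_def)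

text \<open>The point is closure in \<open>T\<close>: the action of \<open>f\<close> is built from
  \<open>v\<close> by scaling, addition and brackets with elements of \<open>B\<close>, all of which
  stay in \<open>T\<close>. The remaining laws are identities between entries.\<close>

lemma poly_action_mat:
  fixes T :: "('i, 'l, 'k::field) mat_elem set"
  assumes T: "lie_subalgebra mat_scale mat_br M T" and B: "B \<subseteq> T"
  shows "poly_action mat_scale mat_br {p \<in> T. fst p = 0} B mat_poly_act"
proof -
  interpret vector_space "mat_scale :: 'k \<Rightarrow> ('i, 'l, 'k) mat_elem \<Rightarrow> ('i, 'l, 'k) mat_elem"
    by (rule vector_space_mat_scale)
  have sub: "subspace T" "\<And>x y. x \<in> T \<Longrightarrow> y \<in> T \<Longrightarrow> mat_br x y \<in> T"
    using T by (auto simp: lie_subalgebra_def)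
  have "mat_poly_act v f \<in> T" if f: "f \<in> polys_in B" and v: "v \<in> T" "fst v = 0" for v f
    using f
  proof (induction rule: polys_in_induct)
    case (const c)
    have "mat_poly_act v (pconst c) = mat_scale c v"
      using v by (auto intro!: mat_eqI simp: mult.commute)
    then show ?case
      using v sub(1) by (simp add: subspace_scale)
  next
    case (add p q)
    have "mat_poly_act v (p + q) = mat_poly_act v p + mat_poly_act v q"
      by (auto intro!: mat_eqI simp: lookup_add poly_subst_add algebra_simps)
    then show ?case
      using add sub(1) by (simp add: subspace_add)
  next
    case (mult_var p b)
    have "mat_poly_act v (p * pvar b) = mat_br (mat_poly_act v p) b"
      by (auto intro!: mat_eqI simp: poly_subst_mult algebra_simps)
    then show ?case
      using sub(2) [of _ b] mult_var B by (metis subsetD)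
  qed
  then show ?thesis
    unfolding poly_action_def
    by (auto intro!: mat_eqI simp: lookup_add poly_subst_add poly_subst_mult algebra_simps)
qed

text \<open>The axioms prescribe the action of constants, sums and products with a variable, which
  leaves no freedom. Since \<open>U_algebra\<close> speaks of every action, this reduces
  torsion-freeness to the substitution.\<close>

lemma poly_action_mat_unique:
  assumes act: "poly_action mat_scale mat_br {p \<in> T. fst p = 0} B act"
    and f: "f \<in> polys_in B" and v: "v \<in> T" "fst v = 0"
  shows "act v f = mat_poly_act v f"
proof -
  let ?J = "{p \<in> T. fst p = 0}"
  have vJ: "v \<in> ?J"
    using v by simp
  show ?thesis
    using f
  proof (induction rule: polys_in_induct)
    case (const c)
    show ?case
      unfolding poly_action_pconst [OF act vJ]
      using v by (auto intro!: mat_eqI simp: mult.commute)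
  next
    case (add p q)
    have "act v (p + q) = act v p + act v q"
      using poly_actionD(4) [OF act vJ] add by blast
    then show ?case
      using add by (auto intro!: mat_eqI simp: lookup_add poly_subst_add algebra_simps)
  next
    case (mult_var p b)
    have J: "act v p \<in> ?J"
      using poly_actionD(1) [OF act vJ] mult_var by blast
    have "act v (p * pvar b) = act (act v p) (pvar b)"
      using poly_actionD(8) [OF act vJ] mult_var by simp
    also have "\<dots> = mat_br (act v p) b"
      using poly_actionD(3) [OF act J] mult_var by blast
    finally show ?case
      using mult_var by (auto intro!: mat_eqI simp: poly_subst_mult algebra_simps)
  qed
qed

text \<open>If \<open>v\<close> has a nonzero entry, absence of zero divisors makes the substituted
  polynomial vanish. The forms substituted are linearly independent, because a relation among them
  is a combination of \<open>B\<close> with upper left entry 0, that is, a relation modulo the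
  ideal; so \<open>f = 0\<close>.\<close>

lemma torsion_free_mat:
  fixes T :: "('i, 'l, 'k::field) mat_elem set"
  assumes T: "lie_subalgebra mat_scale mat_br (matM0 I \<Lambda>) T"
    and B: "quotient_basis mat_scale T {p \<in> T. fst p = 0} B"
    and act: "poly_action mat_scale mat_br {p \<in> T. fst p = 0} B act"
  shows "torsion_free_action {p \<in> T. fst p = 0} B act"
  unfolding torsion_free_action_def
proof (intro ballI impI)
  interpret vector_space "mat_scale :: 'k \<Rightarrow> ('i, 'l, 'k) mat_elem \<Rightarrow> ('i, 'l, 'k) mat_elem"
    by (rule vector_space_mat_scale)
  have TM: "T \<subseteq> matM0 I \<Lambda>" and "subspace T"
    using T by (auto simp: lie_subalgebra_def)
  have BT: "B \<subseteq> T"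
    using B by (simp add: quotient_basis_def)
  fix v f assume v: "v \<in> {p \<in> T. fst p = 0}" and f: "f \<in> polys_in B" and eq: "act v f = 0"
  have "mat_poly_act v f = 0"
    using poly_action_mat_unique [OF act f] v eq by auto
  then have "Poly_Mapping.lookup (snd (mat_poly_act v f)) i = 0" for i
    by simp
  then have *: "Poly_Mapping.lookup (snd v) i = 0 \<or> poly_subst fst f = 0" for i
    by (simp add: mpoly_mult_eq_0_iff)
  have "f = 0" if "poly_subst fst f = 0"
  proof (rule poly_subst_independent_linear_forms [OF _ _ f that])
    fix b assume "b \<in> B"
    then show "\<forall>m\<in>Poly_Mapping.keys (fst b). \<exists>\<alpha>. m = Poly_Mapping.single \<alpha> 1"
      using BT TM unfolding matM0_def by blast
  next
    fix B' c assume B': "finite B'" "B' \<subseteq> B" "(\<Sum>b\<in>B'. pconst (c b) * fst b) = 0"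
    have "fst (\<Sum>b\<in>B'. mat_scale (c b) b) = (\<Sum>b\<in>B'. pconst (c b) * fst b)"
      by (induction B' rule: infinite_finite_induct) simp_all
    moreover have "(\<Sum>b\<in>B'. mat_scale (c b) b) \<in> T"
      by (rule subspace_sum) (use \<open>subspace T\<close> B'(2) BT in \<open>auto intro: subspace_scale\<close>)
    ultimately have "(\<Sum>b\<in>B'. mat_scale (c b) b) \<in> {p \<in> T. fst p = 0}"
      using B'(3) by simp
    then show "\<forall>b\<in>B'. c b = 0"
      using B B'(1,2) unfolding quotient_basis_def by blast
  qed
  moreover have "v = 0" if "poly_subst fst f \<noteq> 0"
    using * that v by (intro mat_eqI) auto
  ultimately show "v = 0 \<or> f = 0"
    by blast
qed

lemma U_algebra_subalgebra_matM0:
  fixes T :: "('i, 'l, 'k::field) mat_elem set"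
  assumes T: "lie_subalgebra mat_scale mat_br (matM0 I \<Lambda>) T"
  shows "U_algebra mat_scale mat_br T"
proof -
  define J where "J = {p \<in> T. fst p = 0}"
  have vs: "vector_space (mat_scale :: 'k \<Rightarrow> ('i, 'l, 'k) mat_elem \<Rightarrow> ('i, 'l, 'k) mat_elem)"
    by (rule vector_space_mat_scale)
  then interpret vector_space "mat_scale :: 'k \<Rightarrow> ('i, 'l, 'k) mat_elem \<Rightarrow> ('i, 'l, 'k) mat_elem" .
  have lie: "lie_algebra mat_scale mat_br T"
    by (rule lie_algebra_mat [OF T])
  have J: "nilpotent_ideal mat_scale mat_br T J"
    unfolding J_def by (intro abelian_ideal_nilpotent vs lie_ideal_mat_fst_0 [OF T] abelian_mat_fst_0)
  show ?thesis
  proof (cases "J = {0}")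
    \<comment> \<open>All brackets lie in \<open>J\<close>, so \<open>T\<close> is abelian and is
      its own Fitting radical. The quotient is 0, its basis empty, and the ring is
      \<open>k\<close>.\<close>
    case True
    have br0: "mat_br x y = 0" if "x \<in> T" "y \<in> T" for x y
    proof -
      have "mat_br x y \<in> J"
        using T that by (auto simp: J_def lie_subalgebra_def)
      then show ?thesis
        using True by blast
    qed
    then have ab: "abelian_set mat_br T"
      by (simp add: abelian_set_def)
    have fit: "fitting mat_scale mat_br T = T"
      by (rule fitting_eqI [OF abelian_ideal_nilpotent [OF vs lie_ideal_self [OF lie] ab]])
        (auto simp: nilpotent_ideal_def lie_ideal_def)
    have "quotient_basis mat_scale T T {}"
      using span_superset by (simp add: quotient_basis_def)
    then show ?thesis
      unfolding U_algebra_def fit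
      using metabelian_mat [OF T] ab poly_action_constants [OF lie] torsion_free_constants [OF vs]
        quotient_basis_self [OF _ vs] by blast
  next
    case False
    have "0 \<in> J"
      using J subspace_0
      by (auto simp: nilpotent_ideal_def lie_ideal_def)
    \<comment> \<open>A nonzero \<open>t\<close> in \<open>J\<close> is the test vector that forces
      every nilpotent ideal into \<open>J\<close>.\<close>
    with False obtain t where "t \<in> T" "fst t = 0" "t \<noteq> 0"
      by (auto simp: J_def)
    then have fit: "fitting mat_scale mat_br T = J"
      using J nilpotent_ideal_mat_subset [OF T] unfolding J_def by (intro fitting_eqI) auto
    obtain B where B: "quotient_basis mat_scale T J B"
    proof -
      have "subspace J" "J \<subseteq> T" "subspace T"
        using J T by (simp_all add: nilpotent_ideal_def lie_ideal_def lie_subalgebra_def)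
      then show thesis
        using exists_quotient_basis [OF vs] that by metis
    qed
    then have "poly_action mat_scale mat_br J B mat_poly_act"
      using poly_action_mat [OF T] by (auto simp: J_def quotient_basis_def)
    moreover have "abelian_set mat_br J"
      unfolding J_def by (rule abelian_mat_fst_0)
    ultimately show ?thesis
      unfolding U_algebra_def fit
      using metabelian_mat [OF T] B torsion_free_mat [OF T] unfolding J_def by blast
  qed
qed

section \<open>Finitely generated submodules of a torsion-free module\<close>

locale torsion_free_poly_module = vector_space sc
  for sc :: "'k::field \<Rightarrow> 'a::ab_group_add \<Rightarrow> 'a" +
  fixes br :: "'a \<Rightarrow> 'a \<Rightarrow> 'a" and F B :: "'a set" and act :: "'a \<Rightarrow> ('a, 'k) mpoly \<Rightarrow> 'a"
  assumes F_subspace: "subspace F"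
    and act: "poly_action sc br F B act"
    and torsion_free: "torsion_free_action F B act"
begin

abbreviation R :: "('a, 'k) mpoly set" where "R \<equiv> polys_in B"

lemmas act_closed = poly_actionD(1) [OF act]
  and act_1 = poly_actionD(2) [OF act]
  and act_pvar = poly_actionD(3) [OF act]
  and act_add_right = poly_actionD(4) [OF act]
  and act_pconst_mult = poly_actionD(5) [OF act]
  and act_add_left = poly_actionD(6) [OF act]
  and act_scale_left = poly_actionD(7) [OF act]
  and act_mult = poly_actionD(8) [OF act]
  and act_pconst = poly_action_pconst [OF act]

lemma F_0: "0 \<in> F"
  by (rule subspace_0 [OF F_subspace])

lemma F_add: "v \<in> F \<Longrightarrow> w \<in> F \<Longrightarrow> v + w \<in> F"
  by (rule subspace_add [OF F_subspace])

lemma act_0_right: "v \<in> F \<Longrightarrow> act v 0 = 0"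
  using act_pconst [of v 0] by simp

lemma act_0_left: "f \<in> R \<Longrightarrow> act 0 f = 0"
  using act_scale_left [OF F_0, of f 0] by simp

lemma act_diff_right: "v \<in> F \<Longrightarrow> f \<in> R \<Longrightarrow> g \<in> R \<Longrightarrow> act v (f - g) = act v f - act v g"
  using act_add_right [of v "f - g" g] by (simp add: eq_diff_eq)

lemma act_sum_right:
  "v \<in> F \<Longrightarrow> (\<And>i. i \<in> I \<Longrightarrow> f i \<in> R) \<Longrightarrow> act v (sum f I) = (\<Sum>i\<in>I. act v (f i))"
  by (induction I rule: infinite_finite_induct) (simp_all add: act_0_right act_add_right)

lemma act_sum_left:
  "f \<in> R \<Longrightarrow> (\<And>i. i \<in> I \<Longrightarrow> v i \<in> F) \<Longrightarrow> act (sum v I) f = (\<Sum>i\<in>I. act (v i) f)"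
proof (induction I rule: infinite_finite_induct)
  case (insert i I)
  then have "sum v I \<in> F"
    by (intro subspace_sum [OF F_subspace]) auto
  with insert show ?case
    by (simp add: act_add_left)
qed (simp_all add: act_0_left)

lemma act_commute: "v \<in> F \<Longrightarrow> f \<in> R \<Longrightarrow> g \<in> R \<Longrightarrow> act (act v f) g = act (act v g) f"
  by (simp add: mult.commute flip: act_mult)

lemma act_eq_0: "v \<in> F \<Longrightarrow> f \<in> R \<Longrightarrow> act v f = 0 \<Longrightarrow> f \<noteq> 0 \<Longrightarrow> v = 0"
  using torsion_free unfolding torsion_free_action_def by blast

section \<open>Submodules generated by finite sets, and independence over \<open>R\<close>\<close>

definition comb :: "'a set \<Rightarrow> 'a set" where
  "comb E = {(\<Sum>e\<in>E. act e (c e)) | c. \<forall>e\<in>E. c e \<in> R}"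

lemma combI: "(\<And>e. e \<in> E \<Longrightarrow> c e \<in> R) \<Longrightarrow> (\<Sum>e\<in>E. act e (c e)) \<in> comb E"
  unfolding comb_def by blast

lemma combE:
  assumes "v \<in> comb E"
  obtains c where "\<And>e. e \<in> E \<Longrightarrow> c e \<in> R" "v = (\<Sum>e\<in>E. act e (c e))"
  using assms unfolding comb_def by blast

lemma comb_subset: "E \<subseteq> F \<Longrightarrow> comb E \<subseteq> F"
  by (auto elim!: combE intro!: subspace_sum [OF F_subspace] act_closed)

lemma comb_act:
  assumes "E \<subseteq> F" "v \<in> comb E" "f \<in> R"
  shows "act v f \<in> comb E"
proof -
  obtain c where c: "\<And>e. e \<in> E \<Longrightarrow> c e \<in> R" "v = (\<Sum>e\<in>E. act e (c e))"
    using assms(2) by (rule combE) blast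
  have eF: "e \<in> F" if "e \<in> E" for e
    using assms(1) that by blast
  have "act v f = (\<Sum>e\<in>E. act e (c e * f))"
    using c assms(3) by (simp add: act_sum_left act_mult act_closed eF)
  then show ?thesis
    using combI [of E "\<lambda>e. c e * f"] c assms(3) by simp
qed

lemma comb_subspace:
  assumes "E \<subseteq> F"
  shows "subspace (comb E)"
proof (rule subspaceI)
  have eF: "e \<in> F" if "e \<in> E" for e
    using assms that by blast
  show "0 \<in> comb E"
    using combI [of E "\<lambda>_. 0"] by (simp add: act_0_right eF)
  show "v + w \<in> comb E" if vw: "v \<in> comb E" "w \<in> comb E" for v w
  proof -
    obtain c where c: "\<And>e. e \<in> E \<Longrightarrow> c e \<in> R" "v = (\<Sum>e\<in>E. act e (c e))"
      using vw(1) by (rule combE) blast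
    obtain d where d: "\<And>e. e \<in> E \<Longrightarrow> d e \<in> R" "w = (\<Sum>e\<in>E. act e (d e))"
      using vw(2) by (rule combE) blast
    have "v + w = (\<Sum>e\<in>E. act e (c e + d e))"
      using c d by (simp add: act_add_right eF sum.distrib)
    then show ?thesis
      using combI [of E "\<lambda>e. c e + d e"] c d by simp
  qed
  show "sc a v \<in> comb E" if v: "v \<in> comb E" for a v
    using comb_act [OF assms v polys_in_pconst, of a] act_pconst [of v a] comb_subset [OF assms] v
    by auto
qed

lemma comb_base:
  assumes "finite E" "E \<subseteq> F" "e \<in> E"
  shows "e \<in> comb E"
proof -
  have "(\<Sum>x\<in>E. act x (if x = e then 1 else 0)) = (\<Sum>x\<in>E. if x = e then e else 0)"
    using assms by (intro sum.cong) (auto simp: act_1 act_0_right)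
  then show ?thesis
    using combI [of E "\<lambda>x. if x = e then 1 else 0"] assms by simp
qed

definition indep :: "'a set \<Rightarrow> bool" where
  "indep E \<longleftrightarrow> (\<forall>c. (\<forall>e\<in>E. c e \<in> R) \<longrightarrow> (\<Sum>e\<in>E. act e (c e)) = 0 \<longrightarrow> (\<forall>e\<in>E. c e = 0))"

lemma indepD:
  "indep E \<Longrightarrow> (\<And>e. e \<in> E \<Longrightarrow> c e \<in> R) \<Longrightarrow> (\<Sum>e\<in>E. act e (c e)) = 0 \<Longrightarrow> \<forall>e\<in>E. c e = 0"
  unfolding indep_def by blast

text \<open>Let \<open>E\<close> be maximal among the independent subsets of \<open>G\<close>.
  Adding a further generator \<open>g\<close> creates a relation, in which the coefficient of
  \<open>g\<close> is nonzero because \<open>E\<close> is independent; this coefficient multiplies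
  \<open>g\<close> into \<open>comb E\<close>. The product of these finitely many denominators is
  nonzero and serves all generators.\<close>

lemma exists_common_denominator:
  assumes G: "finite G" "G \<subseteq> F"
  obtains E r where "E \<subseteq> G" "indep E" "r \<in> R" "r \<noteq> 0" "\<And>g. g \<in> G \<Longrightarrow> act g r \<in> comb E"
proof -
  have "finite {E. E \<subseteq> G \<and> indep E}" "{} \<in> {E. E \<subseteq> G \<and> indep E}"
    using G(1) by (simp_all add: indep_def)
  then obtain E where E: "E \<in> {E. E \<subseteq> G \<and> indep E}"
      and max: "\<And>E'. E' \<in> {E. E \<subseteq> G \<and> indep E} \<Longrightarrow> E \<subseteq> E' \<Longrightarrow> E = E'"
    by (metis (no_types, lifting) finite_has_maximal2)
  have EG: "E \<subseteq> G" and iE: "indep E"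
    using E by auto
  then have EF: "E \<subseteq> F" and fE: "finite E"
    using G by (auto intro: finite_subset)
  have "\<exists>r. r \<in> R \<and> r \<noteq> 0 \<and> act g r \<in> comb E" if g: "g \<in> G" for g
  proof (cases "g \<in> E")
    case True
    then have "act g 1 \<in> comb E"
      using comb_base [OF fE EF True] EF act_1 by auto
    then show ?thesis
      by (intro exI [of _ 1]) simp
  next
    case False
    then have "\<not> indep (insert g E)"
      using max [of "insert g E"] EG g by auto
    then obtain c where c: "\<forall>e\<in>insert g E. c e \<in> R" "(\<Sum>e\<in>insert g E. act e (c e)) = 0"
        "\<not> (\<forall>e\<in>insert g E. c e = 0)"
      unfolding indep_def by blast
    have gF: "g \<in> F"
      using g G by blast
    have eq: "act g (c g) + (\<Sum>e\<in>E. act e (c e)) = 0"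
      using c(2) False fE by simp
    have "c g \<noteq> 0"
    proof
      assume "c g = 0"
      with eq gF have "(\<Sum>e\<in>E. act e (c e)) = 0"
        by (simp add: act_0_right)
      then have "\<forall>e\<in>E. c e = 0"
        using iE c(1) unfolding indep_def by blast
      with \<open>c g = 0\<close> c(3) show False
        by blast
    qed
    moreover have "(\<Sum>e\<in>E. act e (c e)) \<in> comb E"
      using c(1) by (intro combI) simp
    then have "act g (c g) \<in> comb E"
      using eq subspace_neg [OF comb_subspace [OF EF]] by (metis add.inverse_inverse eq_neg_iff_add_eq_0)
    ultimately show ?thesis
      using c(1) by blast
  qed
  then obtain r where r: "\<And>g. g \<in> G \<Longrightarrow> r g \<in> R \<and> r g \<noteq> 0 \<and> act g (r g) \<in> comb E"
    by metis
  have prR: "prod r M \<in> R" if "M \<subseteq> G" for M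
    using that r by (intro polys_in_prod) blast
  show thesis
  proof (rule that [OF EG iE])
    show "prod r G \<in> R"
      by (simp add: prR)
    show "prod r G \<noteq> 0"
      using mpoly_prod_eq_0 [OF G(1), of r] r by blast
    show "act g (prod r G) \<in> comb E" if g: "g \<in> G" for g
    proof -
      \<comment> \<open>The factor \<open>r g\<close> is applied first and moves \<open>g\<close>
        into \<open>comb E\<close>; the other factors keep it there.\<close>
      have "prod r G = r g * prod r (G - {g})"
        using G(1) g by (rule prod.remove)
      then have "act g (prod r G) = act (act g (r g)) (prod r (G - {g}))"
        using r g prR [of "G - {g}"] G(2) act_mult [of g "r g" "prod r (G - {g})"] by auto
      then show ?thesis
        using comb_act [OF EF _ prR [of "G - {g}"]] r [OF g] by auto
    qed
  qed
qed

text \<open>A finitely generated torsion-free module embeds into a free one: choose a maximal independent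
  set \<open>E\<close> of generators, multiply by a common denominator and read off coordinates.\<close>

lemma exists_free_embedding:
  assumes G: "finite G" "G \<subseteq> F"
  obtains \<psi> :: "'a \<Rightarrow> 'a \<Rightarrow> ('a, 'k) mpoly"
  where "\<And>v g. v \<in> comb G \<Longrightarrow> \<psi> v g \<in> R"
    "\<And>v w g. v \<in> comb G \<Longrightarrow> w \<in> comb G \<Longrightarrow> \<psi> (v + w) g = \<psi> v g + \<psi> w g"
    "\<And>v f g. v \<in> comb G \<Longrightarrow> f \<in> R \<Longrightarrow> \<psi> (act v f) g = \<psi> v g * f"
    "\<And>v. v \<in> comb G \<Longrightarrow> \<forall>g\<in>G. \<psi> v g = 0 \<Longrightarrow> v = 0"
proof -
  obtain E r where E: "E \<subseteq> G" "indep E" and r: "r \<in> R" "r \<noteq> 0"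
      "\<And>g. g \<in> G \<Longrightarrow> act g r \<in> comb E"
    using exists_common_denominator [OF G] by metis
  have EF: "E \<subseteq> F"
    using E G by blast
  have eF: "e \<in> F" if "e \<in> E" for e
    using EF that by blast
  have GF: "comb G \<subseteq> F"
    by (rule comb_subset [OF G(2)])
  \<comment> \<open>The ring is commutative, so \<open>r\<close> can be applied to each generator
    before its coefficient.\<close>
  have rv: "act v r \<in> comb E" if v: "v \<in> comb G" for v
  proof -
    obtain c where c: "\<And>g. g \<in> G \<Longrightarrow> c g \<in> R" "v = (\<Sum>g\<in>G. act g (c g))"
      using v by (rule combE) blast
    have gF: "g \<in> F" if "g \<in> G" for g
      using G(2) that by blast
    have "act v r = (\<Sum>g\<in>G. act (act g r) (c g))"
      using c r(1) by (simp add: act_sum_left act_closed gF act_commute)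
    also have "\<dots> \<in> comb E"
      by (rule subspace_sum [OF comb_subspace [OF EF]]) (simp add: comb_act [OF EF] r(3) c(1))
    finally show ?thesis .
  qed
  \<comment> \<open>These are the coordinates of \<open>act v r\<close>, not of \<open>v\<close>.
    Requiring 0 outside \<open>E\<close> makes \<open>c\<close> unique as a function and gives
    values at the generators outside \<open>E\<close>.\<close>
  define coords where "coords v c \<longleftrightarrow> (\<forall>e\<in>E. c e \<in> R) \<and> (\<forall>e. e \<notin> E \<longrightarrow> c e = 0)
      \<and> act v r = (\<Sum>e\<in>E. act e (c e))" for v and c :: "'a \<Rightarrow> ('a, 'k) mpoly"
  have unique: "c = d" if "coords v c" "coords v d" for v c d
  proof -
    have cd: "c e \<in> R" "d e \<in> R" if "e \<in> E" for e
      using that \<open>coords v c\<close> \<open>coords v d\<close> unfolding coords_def by auto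
    then have "(\<Sum>e\<in>E. act e (c e - d e)) = (\<Sum>e\<in>E. act e (c e)) - (\<Sum>e\<in>E. act e (d e))"
      by (simp add: act_diff_right eF sum_subtractf)
    also have "\<dots> = 0"
      using that unfolding coords_def by simp
    finally have "\<forall>e\<in>E. c e - d e = 0"
      by (intro indepD [OF E(2)]) (simp_all add: cd)
    moreover have "c e = 0" "d e = 0" if "e \<notin> E" for e
      using that \<open>coords v c\<close> \<open>coords v d\<close> unfolding coords_def by auto
    ultimately show "c = d"
      by (intro ext) (metis eq_iff_diff_eq_0)
  qed
  define \<psi> where "\<psi> v = (SOME c. coords v c)" for v
  have \<psi>: "coords v (\<psi> v)" if v: "v \<in> comb G" for v
  proof -
    obtain c where "\<And>e. e \<in> E \<Longrightarrow> c e \<in> R" "act v r = (\<Sum>e\<in>E. act e (c e))"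
      using rv [OF v] by (rule combE) blast
    then have "coords v (\<lambda>e. if e \<in> E then c e else 0)"
      unfolding coords_def by simp
    then show ?thesis
      unfolding \<psi>_def by (rule someI [of "coords v"])
  qed
  show thesis
  proof
    show "\<psi> v g \<in> R" if "v \<in> comb G" for v g
      using \<psi> [OF that] unfolding coords_def by (cases "g \<in> E") auto
    \<comment> \<open>As \<open>\<psi>\<close> is a choice, its additivity and
      \<open>R\<close>-linearity are obtained by checking that the expected values are coordinates
      and appealing to uniqueness.\<close>
    show "\<psi> (v + w) g = \<psi> v g + \<psi> w g" if vw: "v \<in> comb G" "w \<in> comb G" for v w g
    proof -
      have "v + w \<in> comb G"
        using vw by (rule subspace_add [OF comb_subspace [OF G(2)]])
      moreover have "act (v + w) r = act v r + act w r"
        using vw GF r(1) by (intro act_add_left) auto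
      then have "coords (v + w) (\<lambda>e. \<psi> v e + \<psi> w e)"
        using \<psi> [OF vw(1)] \<psi> [OF vw(2)] unfolding coords_def
        by (simp add: act_add_right eF sum.distrib)
      ultimately show ?thesis
        using unique \<psi> by metis
    qed
    show "\<psi> (act v f) g = \<psi> v g * f" if vf: "v \<in> comb G" "f \<in> R" for v f g
    proof -
      have "act v f \<in> comb G"
        using vf by (rule comb_act [OF G(2)])
      moreover have "act (act v f) r = act (act v r) f"
        using vf GF r(1) by (intro act_commute) auto
      then have "coords (act v f) (\<lambda>e. \<psi> v e * f)"
        using \<psi> [OF vf(1)] vf(2) unfolding coords_def
        by (simp add: act_mult eF act_sum_left act_closed)
      ultimately show ?thesis
        using unique \<psi> by metis
    qed
    show "v = 0" if v: "v \<in> comb G" "\<forall>g\<in>G. \<psi> v g = 0" for v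
    proof -
      have "act v r = 0"
        using \<psi> [OF v(1)] v(2) E(1) unfolding coords_def by (simp add: act_0_right eF subset_iff)
      then show ?thesis
        using act_eq_0 [OF _ r(1) _ r(2)] v(1) GF by blast
    qed
  qed
qed

end

section \<open>Embedding a finitely generated U-algebra\<close>

lemma lie_generated_subset:
  "lie_subalgebra sc br A T \<Longrightarrow> X \<subseteq> T \<Longrightarrow> lie_generated sc br A X \<subseteq> T"
  unfolding lie_generated_def by blast

text \<open>All brackets lie in \<open>F\<close>, so the span of \<open>X\<close> and
  \<open>F\<close> is a subalgebra and hence all of \<open>A\<close>. The quotient by
  \<open>F\<close> is therefore spanned by the finite set \<open>X\<close>.\<close>

lemma finite_quotient_basis:
  assumes lie: "lie_algebra sc br A" and F: "lie_ideal sc br A F"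
    and brF: "\<And>a b. a \<in> A \<Longrightarrow> b \<in> A \<Longrightarrow> br a b \<in> F"
    and B: "quotient_basis sc A F B"
    and X: "finite X" "X \<subseteq> A" "lie_generated sc br A X = A"
  shows "finite B"
proof -
  interpret vector_space sc
    using lie by (simp add: lie_algebra_def)
  have sA: "subspace A" and sF: "subspace F" and FA: "F \<subseteq> A"
    using lie F by (auto simp: lie_algebra_def lie_ideal_def)
  have "span (X \<union> F) \<subseteq> A"
    using X(2) FA by (intro span_minimal sA) simp
  moreover have "F \<subseteq> span (X \<union> F)"
    using span_superset by blast
  ultimately have "lie_subalgebra sc br A (span (X \<union> F))"
    using brF unfolding lie_subalgebra_def by blast
  then have A: "A \<subseteq> span (X \<union> F)"
    using lie_generated_subset [of sc br A "span (X \<union> F)" X] X(3) span_superset [of "X \<union> F"] by simp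
  \<comment> \<open>Each generator involves only finitely many elements of \<open>B\<close> modulo
    \<open>F\<close>. The union \<open>D\<close> of these sets spans \<open>A\<close> modulo
    \<open>F\<close>, which leaves no room for further elements of \<open>B\<close>.\<close>
  have "\<exists>C. finite C \<and> C \<subseteq> B \<and> x \<in> span (C \<union> F)" if "x \<in> X" for x
  proof -
    have "x \<in> span (B \<union> F)"
      using that X(2) B by (auto simp: quotient_basis_def)
    then obtain s t where st: "x = s + t" "s \<in> span B" "t \<in> span F"
      unfolding span_Un by blast
    obtain C u where C: "finite C" "C \<subseteq> B" "s = (\<Sum>a\<in>C. sc (u a) a)"
      using st(2) unfolding span_explicit by blast
    then have "s \<in> span C"
      by (auto intro: span_sum span_scale span_base)
    then have "x \<in> span (C \<union> F)"
      using st unfolding span_Un by blast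
    with C show ?thesis
      by blast
  qed
  then obtain C where C: "\<And>x. x \<in> X \<Longrightarrow> finite (C x) \<and> C x \<subseteq> B \<and> x \<in> span (C x \<union> F)"
    by metis
  define D where "D = (\<Union>x\<in>X. C x)"
  have D: "finite D" "D \<subseteq> B"
    using C X(1) by (auto simp: D_def)
  have "x \<in> span (D \<union> F)" if "x \<in> X" for x
    using C [OF that] that span_mono [of "C x \<union> F" "D \<union> F"] by (auto simp: D_def)
  then have "span (X \<union> F) \<subseteq> span (D \<union> F)"
    by (intro span_minimal) (auto intro: span_base)
  with A have AD: "A \<subseteq> span (D \<union> F)"
    by blast
  have "b \<in> D" if b: "b \<in> B" for b
  proof (rule ccontr)
    assume "b \<notin> D"
    have "b \<in> span (D \<union> F)"
      using b B AD by (auto simp: quotient_basis_def)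
    then obtain s t where st: "b = s + t" "s \<in> span D" "t \<in> span F"
      unfolding span_Un by blast
    have "t \<in> F"
      using st(3) sF by (metis span_eq_iff)
    obtain u where u: "s = (\<Sum>a\<in>D. sc (u a) a)"
      using st(2) unfolding span_finite [OF D(1)] by blast
    \<comment> \<open>With coefficient 1 at \<open>b\<close> and \<open>- u\<close> on
      \<open>D\<close> the combination is \<open>b - s = t\<close>, an element of \<open>F\<close>;
      independence modulo \<open>F\<close> would make the coefficient 1 vanish.\<close>
    have "(\<Sum>a\<in>D. sc ((\<lambda>a. if a = b then 1 else - u a) a) a) = (\<Sum>a\<in>D. - sc (u a) a)"
      using \<open>b \<notin> D\<close> by (intro sum.cong) auto
    also have "\<dots> = - s"
      by (simp add: u sum_negf)
    finally have "(\<Sum>a\<in>insert b D. sc ((\<lambda>a. if a = b then 1 else - u a) a) a) = t"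
      using \<open>b \<notin> D\<close> D(1) st(1) by simp
    moreover have indep: "\<forall>B' c. finite B' \<longrightarrow> B' \<subseteq> B \<longrightarrow> (\<Sum>b\<in>B'. sc (c b) b) \<in> F \<longrightarrow> (\<forall>b\<in>B'. c b = 0)"
      using B by (simp add: quotient_basis_def)
    ultimately show False
      using indep [rule_format, of "insert b D" "\<lambda>a. if a = b then 1 else - u a" b]
        D b \<open>t \<in> F\<close> by simp
  qed
  then have "B \<subseteq> D"
    by blast
  then show ?thesis
    using D(1) by (rule finite_subset)
qed

locale metabelian_module = torsion_free_poly_module sc br F B act
  for sc :: "'k::field \<Rightarrow> 'a::ab_group_add \<Rightarrow> 'a" and br F B act +
  fixes A :: "'a set"
  assumes lie: "lie_algebra sc br A"
    and ideal: "lie_ideal sc br A F"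
    and abelian: "abelian_set br F"
    and br_in_F: "\<And>a b. a \<in> A \<Longrightarrow> b \<in> A \<Longrightarrow> br a b \<in> F"
    and basis: "quotient_basis sc A F B"
    and finite_B: "finite B"
begin

lemma A_subspace: "subspace A"
  using lie by (simp add: lie_algebra_def)

lemma F_subset_A: "F \<subseteq> A"
  using ideal by (simp add: lie_ideal_def)

lemma B_subset_A: "B \<subseteq> A"
  using basis by (simp add: quotient_basis_def)

lemmas A_add = subspace_add [OF A_subspace]
  and A_scale = subspace_scale [OF A_subspace]

lemma br_add_left: "x \<in> A \<Longrightarrow> y \<in> A \<Longrightarrow> z \<in> A \<Longrightarrow> br (x + y) z = br x z + br y z"
  and br_add_right: "x \<in> A \<Longrightarrow> y \<in> A \<Longrightarrow> z \<in> A \<Longrightarrow> br z (x + y) = br z x + br z y"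
  and br_scale_left: "x \<in> A \<Longrightarrow> y \<in> A \<Longrightarrow> br (sc c x) y = sc c (br x y)"
  and br_scale_right: "x \<in> A \<Longrightarrow> y \<in> A \<Longrightarrow> br x (sc c y) = sc c (br x y)"
  and br_self: "x \<in> A \<Longrightarrow> br x x = 0"
  and jacobi: "x \<in> A \<Longrightarrow> y \<in> A \<Longrightarrow> z \<in> A \<Longrightarrow> br x (br y z) + br y (br z x) + br z (br x y) = 0"
  using lie unfolding lie_algebra_def by simp_all

lemma br_in_A: "x \<in> A \<Longrightarrow> y \<in> A \<Longrightarrow> br x y \<in> A"
  using br_in_F F_subset_A by blast

lemma br_anti: "x \<in> A \<Longrightarrow> y \<in> A \<Longrightarrow> br x y = - br y x"
  using br_self [of "x + y"] br_self [of x] br_self [of y]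
  by (simp add: br_add_left br_add_right A_add eq_neg_iff_add_eq_0 add.commute)

lemma br_0_left: "y \<in> A \<Longrightarrow> br 0 y = 0"
  using br_scale_left [of 0 y 0] subspace_0 [OF A_subspace] by simp

lemma br_0_right: "x \<in> A \<Longrightarrow> br x 0 = 0"
  using br_scale_right [of x 0 0] subspace_0 [OF A_subspace] by simp

lemma br_sum_right:
  "x \<in> A \<Longrightarrow> (\<And>i. i \<in> I \<Longrightarrow> f i \<in> A) \<Longrightarrow> br x (sum f I) = (\<Sum>i\<in>I. br x (f i))"
proof (induction I rule: infinite_finite_induct)
  case (insert i I)
  then have "sum f I \<in> A"
    by (intro subspace_sum [OF A_subspace]) auto
  with insert show ?case
    by (simp add: br_add_right)
qed (simp_all add: br_0_right)

section \<open>Coordinates modulo \<open>F\<close> and the linear forms they define\<close>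

definition coord :: "'a \<Rightarrow> 'a \<Rightarrow> 'k" where
  "coord a = (SOME c. a - (\<Sum>b\<in>B. sc (c b) b) \<in> F)"

text \<open>This is the map \<open>\<pi>\<close> of the introduction. The choice in
  \<open>coord\<close> is determined only on \<open>B\<close>, and only those values enter
  here.\<close>

definition lin :: "'a \<Rightarrow> ('a, 'k) mpoly" where
  "lin a = (\<Sum>b\<in>B. pconst (coord a b) * pvar b)"

lemma coord:
  assumes "a \<in> A"
  shows "a - (\<Sum>b\<in>B. sc (coord a b) b) \<in> F"
proof -
  have "a \<in> span (B \<union> F)"
    using basis assms by (auto simp: quotient_basis_def)
  then obtain s t where st: "a = s + t" "s \<in> span B" "t \<in> span F"
    unfolding span_Un by blast
  obtain u where "s = (\<Sum>a\<in>B. sc (u a) a)"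
    using st(2) unfolding span_finite [OF finite_B] by blast
  moreover have "t \<in> F"
    using st(3) F_subspace by (metis span_eq_iff)
  ultimately have "a - (\<Sum>b\<in>B. sc (u b) b) \<in> F"
    using st(1) by simp
  then show ?thesis
    unfolding coord_def by (rule someI [of "\<lambda>c. a - (\<Sum>b\<in>B. sc (c b) b) \<in> F"])
qed

lemma coord_unique:
  assumes "a \<in> A" "a - (\<Sum>b\<in>B. sc (c b) b) \<in> F" "b \<in> B"
  shows "coord a b = c b"
proof -
  have "(\<Sum>b\<in>B. sc (coord a b - c b) b)
      = (a - (\<Sum>b\<in>B. sc (c b) b)) - (a - (\<Sum>b\<in>B. sc (coord a b) b))"
    by (simp add: scale_left_diff_distrib sum_subtractf)
  also have "\<dots> \<in> F"
    by (intro subspace_diff [OF F_subspace] coord assms)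
  finally have *: "(\<Sum>b\<in>B. sc (coord a b - c b) b) \<in> F" .
  have "\<forall>B' c. finite B' \<longrightarrow> B' \<subseteq> B \<longrightarrow> (\<Sum>b\<in>B'. sc (c b) b) \<in> F \<longrightarrow> (\<forall>b\<in>B'. c b = 0)"
    using basis by (simp add: quotient_basis_def)
  from this [rule_format, OF finite_B order_refl * assms(3)] show ?thesis
    by simp
qed

lemma lin_in_R: "lin a \<in> R"
  by (simp add: lin_def)

lemma lin_add:
  assumes "x \<in> A" "y \<in> A"
  shows "lin (x + y) = lin x + lin y"
proof -
  have "x + y - (\<Sum>b\<in>B. sc (coord x b + coord y b) b)
      = (x - (\<Sum>b\<in>B. sc (coord x b) b)) + (y - (\<Sum>b\<in>B. sc (coord y b) b))"
    by (simp add: scale_left_distrib sum.distrib)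
  also have "\<dots> \<in> F"
    by (intro F_add coord assms)
  finally have "coord (x + y) b = coord x b + coord y b" if "b \<in> B" for b
    using coord_unique [of "x + y" "\<lambda>b. coord x b + coord y b"] that assms A_add by blast
  then show ?thesis
    by (simp add: lin_def pconst_add distrib_right sum.distrib)
qed

lemma lin_scale:
  assumes "x \<in> A"
  shows "lin (sc c x) = pconst c * lin x"
proof -
  have "sc c x - (\<Sum>b\<in>B. sc (c * coord x b) b) = sc c (x - (\<Sum>b\<in>B. sc (coord x b) b))"
    by (simp add: scale_right_diff_distrib scale_sum_right)
  also have "\<dots> \<in> F"
    by (intro subspace_scale [OF F_subspace] coord assms)
  finally have "coord (sc c x) b = c * coord x b" if "b \<in> B" for b
    using coord_unique [of "sc c x" "\<lambda>b. c * coord x b"] that assms A_scale by blast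
  then show ?thesis
    by (simp add: lin_def pconst_mult sum_distrib_left mult.assoc)
qed

lemma lin_F:
  assumes "v \<in> F"
  shows "lin v = 0"
proof -
  have "coord v b = 0" if "b \<in> B" for b
    using coord_unique [of v "\<lambda>_. 0" b] that assms F_subset_A by auto
  then show ?thesis
    by (simp add: lin_def)
qed

lemma lookup_lin: "b \<in> B \<Longrightarrow> Poly_Mapping.lookup (lin a) (Poly_Mapping.single b 1) = coord a b"
proof -
  assume b: "b \<in> B"
  have "Poly_Mapping.lookup (lin a) (Poly_Mapping.single b 1)
      = (\<Sum>x\<in>B. if x = b then coord a x else 0)"
    unfolding lin_def lookup_sum
  proof (rule sum.cong)
    fix x
    have "Poly_Mapping.single x (1 :: nat) = Poly_Mapping.single b 1 \<longleftrightarrow> x = b"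
      by (metis keys_single singleton_inject zero_neq_one)
    then show "Poly_Mapping.lookup (pconst (coord a x) * pvar x) (Poly_Mapping.single b 1)
        = (if x = b then coord a x else 0)"
      by (simp add: lookup_pconst_mult pvar_def lookup_single)
  qed simp
  then show ?thesis
    using b finite_B by simp
qed

lemma lin_eq_0:
  assumes "a \<in> A" "lin a = 0"
  shows "a \<in> F"
proof -
  have "coord a b = 0" if "b \<in> B" for b
    using lookup_lin [OF that, of a] assms(2) by simp
  then show ?thesis
    using coord [OF assms(1)] by simp
qed

text \<open>Modulo \<open>F\<close>, \<open>a\<close> is a combination of basis elements, whose
  brackets with \<open>v\<close> are the actions of the variables. The remainder lies in the abelian
  ideal \<open>F\<close> and so contributes nothing.\<close>

lemma act_lin:
  assumes v: "v \<in> F" and a: "a \<in> A"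
  shows "act v (lin a) = br v a"
proof -
  have bA: "b \<in> A" if "b \<in> B" for b
    using B_subset_A that by blast
  have vA: "v \<in> A"
    using v F_subset_A by blast
  let ?s = "\<Sum>b\<in>B. sc (coord a b) b"
  have sA: "?s \<in> A"
    by (rule subspace_sum [OF A_subspace]) (simp add: A_scale bA)
  have "act v (lin a) = (\<Sum>b\<in>B. sc (coord a b) (br v b))"
    by (simp add: lin_def act_sum_right act_pconst_mult act_pvar v)
  also have "\<dots> = br v ?s"
    by (simp add: br_sum_right br_scale_right vA A_scale bA)
  also have "\<dots> = br v (?s + (a - ?s))"
  proof -
    have "br v (a - ?s) = 0"
      using abelian v coord [OF a] by (simp add: abelian_set_def)
    then show ?thesis
      using br_add_right [of ?s "a - ?s" v] sA vA coord [OF a] F_subset_A by auto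
  qed
  finally show ?thesis
    by simp
qed

text \<open>The map \<open>\<theta>\<close> plays the role of the bracket with a fixed element outside \<open>F\<close>, for which the
  compatibility condition is the Jacobi identity.\<close>

lemma embeddingI:
  assumes G: "finite G" "G \<subseteq> F"
    and \<theta>: "\<And>a. a \<in> A \<Longrightarrow> \<theta> a \<in> comb G"
      "\<And>a b. a \<in> A \<Longrightarrow> b \<in> A \<Longrightarrow> \<theta> (a + b) = \<theta> a + \<theta> b"
      "\<And>c a. a \<in> A \<Longrightarrow> \<theta> (sc c a) = sc c (\<theta> a)"
      "\<And>a b. a \<in> A \<Longrightarrow> b \<in> A \<Longrightarrow> \<theta> (br a b) + act (\<theta> b) (lin a) = act (\<theta> a) (lin b)"
      "\<And>a. a \<in> F \<Longrightarrow> \<theta> a = 0 \<Longrightarrow> a = 0"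
  shows "\<exists>\<phi> :: 'a \<Rightarrow> (nat, nat, 'k) mat_elem. lie_embedding sc br A mat_scale mat_br \<phi>
    \<and> \<phi> ` A \<subseteq> matM0 UNIV UNIV"
proof (rule exists_free_embedding [OF G])
  fix \<psi> :: "'a \<Rightarrow> 'a \<Rightarrow> ('a, 'k) mpoly"
  assume \<psi>: "\<And>v g. v \<in> comb G \<Longrightarrow> \<psi> v g \<in> R"
    "\<And>v w g. v \<in> comb G \<Longrightarrow> w \<in> comb G \<Longrightarrow> \<psi> (v + w) g = \<psi> v g + \<psi> w g"
    "\<And>v f g. v \<in> comb G \<Longrightarrow> f \<in> R \<Longrightarrow> \<psi> (act v f) g = \<psi> v g * f"
    "\<And>v. v \<in> comb G \<Longrightarrow> \<forall>g\<in>G. \<psi> v g = 0 \<Longrightarrow> v = 0"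
  \<comment> \<open>Elements of \<open>B\<close> name the variables and elements of \<open>G\<close>
    the columns; one injection into the naturals transfers both to the fixed index type.\<close>
  obtain h :: "'a \<Rightarrow> nat" where h: "inj_on h (B \<union> G)"
    using finite_imp_inj_to_nat_seg [of "B \<union> G"] finite_B G(1) by auto
  define ren :: "('a, 'k) mpoly \<Rightarrow> (nat, 'k) mpoly" where "ren = poly_subst (\<lambda>v. pvar (h v))"
  have ren_add: "ren (p + q) = ren p + ren q" and ren_mult: "ren (p * q) = ren p * ren q"
    and ren_pconst: "ren (pconst c) = pconst c" and ren_pvar: "ren (pvar b) = pvar (h b)"
    and ren_sum: "ren (sum f I) = (\<Sum>i\<in>I. ren (f i))" for p q c b and f :: "'a \<Rightarrow> _" and I
    by (simp_all add: ren_def poly_subst_add poly_subst_mult poly_subst_sum)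
  have ren_0: "ren 0 = 0"
    by (simp add: ren_def)
  have ren_eq_0: "p = 0" if "p \<in> R" "ren p = 0" for p
    using poly_subst_rename_eq_0_iff [OF that(1), of h] that(2) h
    by (simp add: ren_def inj_on_Un)
  define row where "row v = (\<Sum>g\<in>G. Poly_Mapping.single (h g) (ren (\<psi> v g)))" for v
  have lookup_row: "Poly_Mapping.lookup (row v) n = (\<Sum>g\<in>G. if h g = n then ren (\<psi> v g) else 0)" for v n
    by (simp add: row_def lookup_sum lookup_single when_def)
  define \<phi> where "\<phi> a = (ren (lin a), row (\<theta> a))" for a
  have GF: "comb G \<subseteq> F"
    by (rule comb_subset [OF G(2)])
  have lookup_row_add: "Poly_Mapping.lookup (row (v + w)) n
      = Poly_Mapping.lookup (row v) n + Poly_Mapping.lookup (row w) n"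
    if "v \<in> comb G" "w \<in> comb G" for v w n
    unfolding lookup_row sum.distrib [symmetric] by (rule sum.cong) (simp_all add: that \<psi>(2) ren_add)
  have lookup_row_act: "Poly_Mapping.lookup (row (act v f)) n = Poly_Mapping.lookup (row v) n * ren f"
    if "v \<in> comb G" "f \<in> R" for v f n
    unfolding lookup_row sum_distrib_right by (rule sum.cong) (simp_all add: that \<psi>(3) ren_mult)
  have add: "\<phi> (x + y) = \<phi> x + \<phi> y" if "x \<in> A" "y \<in> A" for x y
    using that by (intro mat_eqI)
      (simp_all add: \<phi>_def lin_add ren_add \<theta>(1,2) lookup_row_add lookup_add)
  have scale: "\<phi> (sc c x) = mat_scale c (\<phi> x)" if x: "x \<in> A" for c x
  proof (rule mat_eqI)
    show "fst (\<phi> (sc c x)) = fst (mat_scale c (\<phi> x))"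
      using x by (simp add: \<phi>_def lin_scale ren_mult ren_pconst)
    \<comment> \<open>Scaling is the action of a constant, so the \<open>R\<close>-linearity of
      \<open>row\<close> covers it.\<close>
    have "\<theta> (sc c x) = act (\<theta> x) (pconst c)"
      using act_pconst [OF subsetD [OF GF \<theta>(1) [OF x]]] \<theta>(3) [OF x] by simp
    then show "Poly_Mapping.lookup (snd (\<phi> (sc c x))) n
        = Poly_Mapping.lookup (snd (mat_scale c (\<phi> x))) n" for n
      using x by (simp add: \<phi>_def lookup_row_act \<theta>(1) ren_pconst mult.commute)
  qed
  have bracket: "\<phi> (br x y) = mat_br (\<phi> x) (\<phi> y)" if xy: "x \<in> A" "y \<in> A" for x y
  proof (rule mat_eqI)
    show "fst (\<phi> (br x y)) = fst (mat_br (\<phi> x) (\<phi> y))"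
      using xy by (simp add: \<phi>_def lin_F br_in_F ren_0)
    \<comment> \<open>Both summands of the compatibility condition lie in \<open>comb G\<close>, so
      \<open>row\<close> is additive on them; the difference in \<open>mat_br\<close> arises by
      rearranging.\<close>
    have c: "\<theta> (br x y) \<in> comb G" "act (\<theta> y) (lin x) \<in> comb G"
      using xy by (simp_all add: \<theta>(1) br_in_A comb_act [OF G(2)] lin_in_R)
    have "Poly_Mapping.lookup (row (\<theta> (br x y))) n + Poly_Mapping.lookup (row (\<theta> y)) n * ren (lin x)
        = Poly_Mapping.lookup (row (\<theta> x)) n * ren (lin y)" for n
      using lookup_row_add [OF c, of n] xy
      by (simp add: \<theta>(4) lookup_row_act \<theta>(1) lin_in_R)
    then show "Poly_Mapping.lookup (snd (\<phi> (br x y))) n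
        = Poly_Mapping.lookup (snd (mat_br (\<phi> x) (\<phi> y))) n" for n
      by (simp add: \<phi>_def eq_diff_eq)
  qed
  \<comment> \<open>The upper left entry vanishes only on \<open>F\<close>, and there the row
    detects \<open>x\<close> through \<open>\<theta>\<close>.\<close>
  have kernel: "x = 0" if x: "x \<in> A" "\<phi> x = 0" for x
  proof -
    have "ren (lin x) = 0" and row0: "row (\<theta> x) = 0"
      using x(2) by (simp_all add: \<phi>_def zero_prod_def)
    then have "x \<in> F"
      using ren_eq_0 lin_in_R lin_eq_0 x(1) by blast
    moreover have "\<psi> (\<theta> x) g = 0" if g: "g \<in> G" for g
    proof (rule ren_eq_0)
      have "Poly_Mapping.lookup (row (\<theta> x)) (h g) = (\<Sum>g'\<in>G. if g' = g then ren (\<psi> (\<theta> x) g') else 0)"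
        unfolding lookup_row using h g by (intro sum.cong) (auto dest: inj_onD)
      then show "ren (\<psi> (\<theta> x) g) = 0"
        using row0 g G(1) by simp
      show "\<psi> (\<theta> x) g \<in> R"
        using x(1) by (simp add: \<psi>(1) \<theta>(1))
    qed
    then have "\<theta> x = 0"
      using \<psi>(4) [OF \<theta>(1) [OF x(1)]] by blast
    ultimately show "x = 0"
      by (rule \<theta>(5))
  qed
  have "inj_on \<phi> A"
  proof (rule inj_onI)
    fix x y assume xy: "x \<in> A" "y \<in> A" "\<phi> x = \<phi> y"
    have "x - y \<in> A"
      by (intro subspace_diff [OF A_subspace] xy)
    moreover have "\<phi> (x - y) + \<phi> y = \<phi> x"
      using add [of "x - y" y] xy \<open>x - y \<in> A\<close> by simp
    then have "\<phi> (x - y) = 0"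
      using xy(3) by simp
    ultimately show "x = y"
      using kernel [of "x - y"] by simp
  qed
  then have "lie_embedding sc br A mat_scale mat_br \<phi>"
    unfolding lie_embedding_def using add scale bracket by blast
  moreover have "\<phi> a \<in> matM0 UNIV UNIV" for a
  proof -
    have "fst (\<phi> a) = (\<Sum>b\<in>B. pconst (coord a b) * pvar (h b))"
      by (simp add: \<phi>_def lin_def ren_sum ren_mult ren_pconst ren_pvar)
    also have "\<dots> = (\<Sum>b\<in>B. Poly_Mapping.single (Poly_Mapping.single (h b) 1) (coord a b))"
      by (simp add: pvar_def flip: single_eq_pconst_mult)
    finally have "Poly_Mapping.keys (fst (\<phi> a))
        \<subseteq> (\<Union>b\<in>B. Poly_Mapping.keys (Poly_Mapping.single (Poly_Mapping.single (h b) 1) (coord a b)))"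
      using keys_sum by metis
    then have "\<forall>m\<in>Poly_Mapping.keys (fst (\<phi> a)). \<exists>\<alpha>. m = Poly_Mapping.single \<alpha> 1"
      by (fastforce split: if_splits)
    then show ?thesis
      by (simp add: matM0_def matM_def polys_in_def)
  qed
  ultimately show ?thesis
    by blast
qed

text \<open>The sum of the span of the generators and the submodule generated by their brackets is a
  subalgebra, hence it is all of \<open>A\<close>.\<close>

lemma brackets_in_comb:
  assumes X: "finite X" "X \<subseteq> A" "lie_generated sc br A X = A"
    and G: "G = {br x y | x y. x \<in> X \<and> y \<in> X}"
    and ab: "a \<in> A" "b \<in> A"
  shows "br a b \<in> comb G"
proof -
  have "G = (\<lambda>(x, y). br x y) ` (X \<times> X)"
    by (auto simp: G)
  then have fG: "finite G"
    using X(1) by simp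
  have GF: "G \<subseteq> F"
    using X(2) br_in_F by (auto simp: G)
  note sub = comb_subspace [OF GF]
  have CF: "v \<in> F" "v \<in> A" if "v \<in> comb G" for v
    using comb_subset [OF GF] F_subset_A that by auto
  \<comment> \<open>By bilinearity it suffices to bracket the generators: \<open>left\<close> and
    \<open>right\<close> extend the claim from \<open>X\<close> to \<open>span X\<close>, one
    argument at a time.\<close>
  have left: "subspace {s \<in> A. br s y \<in> comb G}" if "y \<in> A" for y
    by (rule subspaceI) (auto simp: that br_0_left br_add_left br_scale_left A_add A_scale
        subspace_0 [OF A_subspace] subspace_0 [OF sub] subspace_add [OF sub] subspace_scale [OF sub])
  have right: "subspace {s \<in> A. br y s \<in> comb G}" if "y \<in> A" for y
    by (rule subspaceI) (auto simp: that br_0_right br_add_right br_scale_right A_add A_scale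
        subspace_0 [OF A_subspace] subspace_0 [OF sub] subspace_add [OF sub] subspace_scale [OF sub])
  have base: "br x y \<in> comb G" if "x \<in> X" "y \<in> X" for x y
    using that by (intro comb_base [OF fG GF]) (auto simp: G)
  have sXA: "s \<in> A" if "s \<in> span X" for s
    using span_minimal [OF X(2) A_subspace] that by blast
  have 1: "br s y \<in> comb G" if s: "s \<in> span X" and y: "y \<in> X" for s y
  proof -
    have "span X \<subseteq> {s \<in> A. br s y \<in> comb G}"
      by (rule span_minimal [OF _ left]) (use X(2) y base in auto)
    then show ?thesis
      using s by blast
  qed
  have 2: "br s s' \<in> comb G" if s: "s \<in> span X" and s': "s' \<in> span X" for s s'
  proof -
    have "span X \<subseteq> {t \<in> A. br s t \<in> comb G}"
      by (rule span_minimal [OF _ right]) (use X(2) 1 s sXA in auto)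
    then show ?thesis
      using s' by blast
  qed
  \<comment> \<open>Bracketing an element of \<open>F\<close> with \<open>a\<close> is
    multiplication by \<open>lin a\<close>, under which a submodule is closed.\<close>
  have 3: "br v a \<in> comb G" if "v \<in> comb G" "a \<in> A" for v a
    using act_lin [of v a] comb_act [OF GF that(1) lin_in_R, of a] that CF by simp
  have 4: "br a v \<in> comb G" if "v \<in> comb G" "a \<in> A" for v a
    using br_anti [of a v] subspace_neg [OF sub 3 [OF that]] that CF by simp
  define W where "W = {s + t | s t. s \<in> span X \<and> t \<in> comb G}"
  have WA: "W \<subseteq> A"
    using sXA CF by (auto simp: W_def intro: A_add)
  have brW: "br x y \<in> comb G" if "x \<in> W" "y \<in> W" for x y
  proof -
    obtain s t where st: "x = s + t" "s \<in> span X" "t \<in> comb G"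
      using \<open>x \<in> W\<close> unfolding W_def by blast
    obtain s' t' where st': "y = s' + t'" "s' \<in> span X" "t' \<in> comb G"
      using \<open>y \<in> W\<close> unfolding W_def by blast
    have "y \<in> A"
      using that WA by blast
    \<comment> \<open>The term with \<open>t\<close> is not expanded, since \<open>3\<close> allows
      any element of \<open>A\<close> as second argument.\<close>
    have "br x y = br s s' + br s t' + br t y"
      using st st' sXA CF \<open>y \<in> A\<close> by (simp add: br_add_left br_add_right)
    moreover have "br s s' \<in> comb G" "br s t' \<in> comb G" "br t y \<in> comb G"
      using st st' 2 3 4 sXA \<open>y \<in> A\<close> by auto
    ultimately show ?thesis
      using subspace_add [OF sub] by simp
  qed
  have "W = span (span X \<union> comb G)"
    unfolding span_Un W_def span_span using sub by (metis span_eq_iff)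
  then have "subspace W"
    by simp
  moreover have "comb G \<subseteq> W"
    using span_zero [of X] unfolding W_def by force
  ultimately have "lie_subalgebra sc br A W"
    using WA brW unfolding lie_subalgebra_def by blast
  moreover have "X \<subseteq> W"
  proof
    fix x assume "x \<in> X"
    then have "x \<in> span X" "0 \<in> comb G"
      by (simp_all add: span_base subspace_0 [OF sub])
    then show "x \<in> W"
      unfolding W_def by force
  qed
  ultimately have "A \<subseteq> W"
    using lie_generated_subset [of sc br A W X] X(3) by simp
  then show ?thesis
    using brW ab by blast
qed

lemma exists_matrix_embedding:
  assumes X: "finite X" "X \<subseteq> A" "lie_generated sc br A X = A"
  shows "\<exists>\<phi> :: 'a \<Rightarrow> (nat, nat, 'k) mat_elem. lie_embedding sc br A mat_scale mat_br \<phi>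
    \<and> \<phi> ` A \<subseteq> matM0 UNIV UNIV"
proof (cases "B = {}")
  case True
  have "A \<subseteq> span F"
    using basis True by (simp add: quotient_basis_def)
  also have "\<dots> \<subseteq> F"
    by (rule span_minimal [OF order_refl F_subspace])
  finally have "A \<subseteq> F" .
  then have AF: "A = F"
    using F_subset_A by blast
  have br0: "br a b = 0" if "a \<in> A" "b \<in> A" for a b
    using abelian that by (simp add: AF abelian_set_def)
  have XF: "X \<subseteq> F"
    using X(2) AF by simp
  have lin0: "lin a = 0" and act0: "act a 0 = 0" if "a \<in> A" for a
    using that by (simp_all add: AF lin_F act_0_right)
  \<comment> \<open>Here \<open>A\<close> is abelian, so the subspace \<open>comb X\<close> is a
    subalgebra and the generators of the algebra also generate the module. All forms
    \<open>lin a\<close> vanish, so \<open>\<theta>\<close> can be the identity.\<close>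
  have "comb X \<subseteq> A"
    using comb_subset [OF XF] AF by simp
  then have "lie_subalgebra sc br A (comb X)"
    using comb_subspace [OF XF] br0 subspace_0 [OF comb_subspace [OF XF]]
    unfolding lie_subalgebra_def by (simp add: subset_iff)
  then have "A \<subseteq> comb X"
    using lie_generated_subset [of sc br A "comb X" X] X(3) comb_base [OF X(1) XF] by blast
  then show ?thesis
    by (intro embeddingI [OF X(1) XF, of "\<lambda>a. a"])
      (auto simp: br0 lin0 act0)
next
  case False
  then obtain b where b: "b \<in> B"
    by blast
  then have bA: "b \<in> A"
    using B_subset_A by blast
  define G where "G = {br x y | x y. x \<in> X \<and> y \<in> X}"
  have "G = (\<lambda>(x, y). br x y) ` (X \<times> X)"
    by (auto simp: G_def)
  then have "finite G"
    using X(1) by simp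
  moreover have "G \<subseteq> F"
    using X(2) br_in_F by (auto simp: G_def)
  ultimately show ?thesis
  proof (rule embeddingI [of G "\<lambda>a. br a b"])
    show "br a b \<in> comb G" if "a \<in> A" for a
      using brackets_in_comb [OF X G_def that bA] .
    show "br (a + a') b = br a b + br a' b" if "a \<in> A" "a' \<in> A" for a a'
      using that bA by (rule br_add_left)
    show "br (sc c a) b = sc c (br a b)" if "a \<in> A" for c a
      using that bA by (rule br_scale_left)
    \<comment> \<open>By \<open>act_lin\<close> both actions are brackets, and the claim becomes the
      Jacobi identity for \<open>x\<close>, \<open>y\<close>, \<open>b\<close>, up to
      antisymmetry.\<close>
    show "br (br x y) b + act (br y b) (lin x) = act (br x b) (lin y)" if xy: "x \<in> A" "y \<in> A" for x y
    proof -
      have "br (br x y) b = - br b (br x y)" "br (br y b) x = - br x (br y b)"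
        using xy bA by (auto intro: br_anti br_in_A)
      moreover have "br (br x b) y = br y (br b x)"
      proof -
        have "br (br x b) y = br (sc (- 1) (br b x)) y"
          using br_anti [OF xy(1) bA] by simp
        also have "\<dots> = - br (br b x) y"
          using br_scale_left [of "br b x" y "- 1"] xy bA by (simp add: br_in_A)
        also have "\<dots> = br y (br b x)"
          using br_anti [of y "br b x"] xy bA by (simp add: br_in_A)
        finally show ?thesis .
      qed
      moreover have "br y (br b x) = - br b (br x y) - br x (br y b)"
        using jacobi [OF xy bA] by (simp add: algebra_simps eq_neg_iff_add_eq_0)
      ultimately show ?thesis
        using xy bA by (simp add: act_lin br_in_F)
    qed
    show "a = 0" if "a \<in> F" "br a b = 0" for a
    proof (rule act_eq_0)
      show "act a (pvar b) = 0"
        using that b by (simp add: act_pvar)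
      show "(pvar b :: ('a, 'k) mpoly) \<noteq> 0"
        by (metis pvar_def lookup_single_eq lookup_zero zero_neq_one)
    qed (use that b in simp_all)
  qed
qed

end

text \<open>The brackets fall into the Fitting radical because their span \<open>D\<close> is an
  abelian, hence nilpotent, ideal. Finite generation then makes the basis of the quotient finite,
  and the embedding argument applies.\<close>

lemma U_algebra_matrix_embedding:
  fixes sc :: "'k::field \<Rightarrow> 'a::ab_group_add \<Rightarrow> 'a"
  assumes fg: "finitely_generated sc br A" and U: "U_algebra sc br A"
  shows "\<exists>\<phi> :: 'a \<Rightarrow> (nat, nat, 'k) mat_elem. lie_embedding sc br A mat_scale mat_br \<phi>
    \<and> \<phi> ` A \<subseteq> matM0 UNIV UNIV"
proof -
  let ?F = "fitting sc br A"
  obtain X where X: "finite X" "X \<subseteq> A" "lie_generated sc br A X = A"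
    using fg unfolding finitely_generated_def by blast
  have mb: "metabelian sc br A" and ab: "abelian_set br ?F"
    using U by (simp_all add: U_algebra_def)
  obtain B act where qb: "quotient_basis sc A ?F B" and act: "poly_action sc br ?F B act"
    using U unfolding U_algebra_def by blast
  then have tf: "torsion_free_action ?F B act"
    using U unfolding U_algebra_def by blast
  have lie: "lie_algebra sc br A"
    using mb by (simp add: metabelian_def)
  interpret vector_space sc
    using lie by (simp add: lie_algebra_def)
  have ideal: "lie_ideal sc br A ?F"
    by (rule lie_ideal_fitting [OF lie])
  have sA: "subspace A" and brA: "\<And>x y. x \<in> A \<Longrightarrow> y \<in> A \<Longrightarrow> br x y \<in> A"
    and add: "\<And>x y z. x \<in> A \<Longrightarrow> y \<in> A \<Longrightarrow> z \<in> A \<Longrightarrow> br (x + y) z = br x z + br y z \<and> br z (x + y) = br z x + br z y"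
    and scale: "\<And>c x y. x \<in> A \<Longrightarrow> y \<in> A \<Longrightarrow> br (sc c x) y = sc c (br x y) \<and> br x (sc c y) = sc c (br x y)"
    using lie unfolding lie_algebra_def by simp_all
  have br0: "br 0 y = 0" "br y 0 = 0" if "y \<in> A" for y
    using scale [of 0 y 0] scale [of y 0 0] that subspace_0 [OF sA] by simp_all
  define D where "D = span {br x y | x y. x \<in> A \<and> y \<in> A}"
  have DA: "D \<subseteq> A"
    unfolding D_def by (rule span_minimal [OF _ sA]) (use brA in blast)
  have brD: "br x y \<in> D" if "x \<in> A" "y \<in> A" for x y
    unfolding D_def by (rule span_base) (use that in blast)
  have "br x y = 0" if x: "x \<in> D" and y: "y \<in> D" for x y
  proof -
    \<comment> \<open>The metabelian law concerns single brackets; it is extended to their span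
      first in the right and then in the left argument.\<close>
    have 1: "br u v = 0" if u: "u \<in> {br x y | x y. x \<in> A \<and> y \<in> A}" and v: "v \<in> D" for u v
    proof -
      have uA: "u \<in> A"
        using u brA by blast
      have "subspace {v \<in> A. br u v = 0}"
        by (rule subspaceI) (auto simp: br0 uA add scale subspace_0 [OF sA] subspace_add [OF sA]
            subspace_scale [OF sA])
      moreover have "{br x y | x y. x \<in> A \<and> y \<in> A} \<subseteq> {v \<in> A. br u v = 0}"
        using u mb brA unfolding metabelian_def by auto
      ultimately show ?thesis
        using v span_minimal unfolding D_def by blast
    qed
    have yA: "y \<in> A"
      using y DA by blast
    have "subspace {u \<in> A. br u y = 0}"
      by (rule subspaceI) (auto simp: br0 yA add scale subspace_0 [OF sA] subspace_add [OF sA]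
          subspace_scale [OF sA])
    moreover have "{br x y | x y. x \<in> A \<and> y \<in> A} \<subseteq> {u \<in> A. br u y = 0}"
      using 1 [OF _ y] brA by blast
    ultimately show ?thesis
      using x span_minimal unfolding D_def by blast
  qed
  then have "abelian_set br D"
    by (simp add: abelian_set_def)
  moreover have "lie_ideal sc br A D"
    using DA brD unfolding lie_ideal_def by (auto simp: D_def)
  ultimately have "D \<subseteq> ?F"
    by (intro nilpotent_ideal_subset_fitting abelian_ideal_nilpotent vector_space_axioms)
  then have brF: "br a b \<in> ?F" if "a \<in> A" "b \<in> A" for a b
    using brD that by blast
  have "finite B"
    by (rule finite_quotient_basis [OF lie ideal brF qb X])
  then interpret metabelian_module sc br ?F B act A
    by unfold_locales (use ideal act tf lie ab brF qb in \<open>simp_all add: lie_ideal_def\<close>)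
  show ?thesis
    by (rule exists_matrix_embedding [OF X])
qed

theorem theorem3p2p1:
  shows "(\<forall>(sc :: 'k::field \<Rightarrow> 'a::ab_group_add \<Rightarrow> 'a) br A.
            finitely_generated sc br A \<and> U_algebra sc br A \<longrightarrow>
            (\<exists>(I :: nat set) (\<Lambda> :: nat set) (\<phi> :: 'a \<Rightarrow> (nat, nat, 'k) mat_elem).
               lie_embedding sc br A mat_scale mat_br \<phi> \<and> \<phi> ` A \<subseteq> matM0 I \<Lambda>))
       \<and> (\<forall>(I :: 'i set) (\<Lambda> :: 'l set) (T :: ('i, 'l, 'k) mat_elem set).
            lie_subalgebra mat_scale mat_br (matM0 I \<Lambda>) T \<longrightarrow> U_algebra mat_scale mat_br T)"
proof (intro conjI allI impI)
  fix sc :: "'k \<Rightarrow> 'a \<Rightarrow> 'a" and br A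
  assume "finitely_generated sc br A \<and> U_algebra sc br A"
  then show "\<exists>(I :: nat set) (\<Lambda> :: nat set) (\<phi> :: 'a \<Rightarrow> (nat, nat, 'k) mat_elem).
      lie_embedding sc br A mat_scale mat_br \<phi> \<and> \<phi> ` A \<subseteq> matM0 I \<Lambda>"
    by (intro exI [of _ UNIV] U_algebra_matrix_embedding) simp_all
qed (rule U_algebra_subalgebra_matM0)

end
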